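(* Let $\mathcal G$ be a rooted digraph, $T>0$ and $r\in(0,1)^N$. Let $\xi\in\Xi$ contain (as a block of consecutive terms) the synchronization string $\zeta$ with respect to some root $i^*\in\mathcal V_R$. Then there exist constants $\bar t\ge0$, $\bar k\in\mathbb Z_{\ge0}$ (not depending on the solution) such that for every maximal solution $x=(\tau,\lambda)$ of $\mathcal H_\xi$ with $\lambda(0,0)=0$ and $\tau(0,0)\in[0,1]^N$ there exists a hybrid time $(t^*,k^* )\in\operatorname{dom}(x)$ with $t^*\le\bar t$, $k^*\le\bar k$, such that $\tau(t,k)\in\mathcal A_s$ for all $(t,k)\in\operatorname{dom}(x)$ with $(t,k)\succeq(t^*,k^* )$.
   Context: $\mathcal G=(\mathcal V,\mathcal E)$ is a simple digraph on $\mathcal V=\{1,\dots,N\}$; $(i,j)\in\mathcal E$ means $j$ is an out-neighbor of $i$; $\mathcal E_i^-$ is the set of out-edges of $i$. A path is a sequence of pairwise distinct vertices with consecutive pairs in $\mathcal E$, its length the number of edges. A root is a vertex from which every other vertex is reachable by a path; $\mathcal V_R$ is the set of roots; rooted means $\mathcal V_R\ne\varnothing$. For a root $i^*$, $\mathcal V_q(i^* )$ is the set of vertices whose shortest path from $i^*$ has length $q$ (so $\mathcal V_0(i^* )=\{i^*\}$), and $q^*$ is the maximal such $q$. Let $\underline r=\min_ir_i$ and $\ell^*:=N(\lfloor1/\underline r\rfloor+1)$. A subgraph $(\mathcal V,\mathcal E')$, $\mathcal E'\subseteq\mathcal E$, is feasible if for every $i$ either $\mathcal E_i^-\subseteq\mathcal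 E'$ or $\mathcal E_i^-\cap\mathcal E'=\varnothing$. $\Xi$ is the set of infinite sequences $\xi=\phi_1\phi_2\cdots$ of feasible subgraphs; write $\phi_\lambda=(\mathcal V,\mathcal E_\lambda)$. For $q=0,\dots,q^*-1$ let $\mathcal G_q=(\mathcal V,\bigcup_{i\in\mathcal V_q(i^* )}\mathcal E_i^-)$. The synchronization string w.r.t. $i^*$ is the finite string $\zeta=\mathcal G_0\cdots\mathcal G_0\,\mathcal G_1\cdots\mathcal G_1\cdots\mathcal G_{q^*-1}\cdots\mathcal G_{q^*-1}$ in which each $\mathcal G_q$ is repeated consecutively $\ell^*$ times (length $\ell^*q^*$). Hybrid system $\mathcal H_\xi$: state $x=(\tau,\lambda)\in\mathbb R^N_{\ge0}\times\mathbb Z_{\ge0}$; flow set $C=[0,1]^N\times\mathbb Z_{\ge0}$ with $\dot\tau=\frac1T\mathbf 1_N$, $\dot\lambda=0$; jump set $D=D_\tau\times\mathbb Z_{\ge0}$, $D_\tau=\{\tau\in[0,1]^N:\max_i\tau_i=1\}$, with $x^+\in G_{\lambda+1}(\tau)\times\{\lambda+1\}$. For $\lambda\ge1$, $G_\lambda$ is the outer-semicontinuous hull (map whose graph is the closure of the graph) of $G_\lambda^0(\tau)=\{g\in\mathbb R^N:g_i=0,\ g_j\in\mathcal R_{j,\lambda}(\tau)\ \forall j\ne i\}$, where $i$ is an agent with $\tau_i=1$ and $\mathcal R_{j,\lambda}(\tau)$ equals $\{0\}$ if $(i,j)\in\mathcal E_\lambda$ and $\tau_j\in[0,r_j)$;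 $\{0,1\}$ if $(i,j)\in\mathcal E_\lambda$ and $\tau_j=r_j$; $\{1\}$ if $(i,j)\in\mathcal E_\lambda$ and $\tau_j\in(r_j,1]$; $\{\tau_j\}$ if $(i,j)\notin\mathcal E_\lambda$. Solutions: a hybrid time domain is $E\subset\mathbb R_{\ge0}\times\mathbb Z_{\ge0}$ whose truncations have the form $\bigcup_k[t_k,t_{k+1}]\times\{k\}$, $0=t_0\le t_1\le\cdots$. A solution is a function $x$ on such a domain, locally absolutely continuous in $t$ for fixed $k$, with $x(0,0)\in C\cup D$; $x(t,k)\in C$ and $\dot x=f(x)$ for a.e. $t$ in flow intervals; and $x(t,k)\in D$, $x(t,k+1)\in G(x(t,k))$ whenever $(t,k),(t,k+1)\in\operatorname{dom}x$. It is maximal if its domain cannot be properly extended. $(t_1,k_1)\preceq(t_2,k_2)$ means $t_1\le t_2$ and $k_1\le k_2$. $\mathcal A_s:=\{\mu\mathbf 1_N:\mu\in[0,1]\}\cup\{0,1\}^N$. *)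

theory Defs
  imports "HOL-Analysis.Analysis"
begin

section \<open>Digraphs (vertex set = the finite type 'n, i.e. N = CARD('n))\<close>

definition simple_digraph :: "('n \<times> 'n) set \<Rightarrow> bool" where
  "simple_digraph E \<longleftrightarrow> (\<forall>i. (i, i) \<notin> E)"

definition out_edges :: "('n \<times> 'n) set \<Rightarrow> 'n \<Rightarrow> ('n \<times> 'n) set" where
  "out_edges E i = {e \<in> E. fst e = i}"

definition is_path :: "('n \<times> 'n) set \<Rightarrow> 'n list \<Rightarrow> bool" where
  "is_path E p \<longleftrightarrow> p \<noteq> [] \<and> distinct p \<and> (\<forall>k. Suc k < length p \<longrightarrow> (p ! k, p ! Suc k) \<in> E)"

definition path_from_to :: "('n \<times> 'n) set \<Rightarrow> 'n \<Rightarrow> 'n \<Rightarrow> 'n list \<Rightarrow> bool" where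
  "path_from_to E i j p \<longleftrightarrow> is_path E p \<and> hd p = i \<and> last p = j"

definition path_length :: "'n list \<Rightarrow> nat" where
  "path_length p = length p - 1"

definition is_root :: "('n \<times> 'n) set \<Rightarrow> 'n \<Rightarrow> bool" where
  "is_root E i \<longleftrightarrow> (\<forall>j. j \<noteq> i \<longrightarrow> (\<exists>p. path_from_to E i j p))"

definition roots :: "('n \<times> 'n) set \<Rightarrow> 'n set" where
  "roots E = {i. is_root E i}"

definition rooted :: "('n \<times> 'n) set \<Rightarrow> bool" where
  "rooted E \<longleftrightarrow> roots E \<noteq> {}"

definition sp_dist :: "('n \<times> 'n) set \<Rightarrow> 'n \<Rightarrow> 'n \<Rightarrow> nat" where
  "sp_dist E i j = (LEAST q. \<exists>p. path_from_to E i j p \<and> path_length p = q)"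

definition Vq :: "('n \<times> 'n) set \<Rightarrow> 'n \<Rightarrow> nat \<Rightarrow> 'n set" where
  "Vq E i q = {j. (\<exists>p. path_from_to E i j p) \<and> sp_dist E i j = q}"

definition qstar :: "('n \<times> 'n) set \<Rightarrow> 'n \<Rightarrow> nat" where
  "qstar E i = Max {q. Vq E i q \<noteq> {}}"

definition feasible :: "('n \<times> 'n) set \<Rightarrow> ('n \<times> 'n) set \<Rightarrow> bool" where
  "feasible E E' \<longleftrightarrow> E' \<subseteq> E \<and>
     (\<forall>i. out_edges E i \<subseteq> E' \<or> out_edges E i \<inter> E' = {})"

text \<open>Sequences \<open>\<xi> = \<phi>\<^sub>1 \<phi>\<^sub>2 \<dots>\<close> are functions on nat; index 0 is unused.
  Each \<open>\<phi>\<^sub>\<lambda>\<close> is represented by its edge set \<open>\<E>\<^sub>\<lambda>\<close> (vertex set is always all of 'n).\<close>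
definition in_Xi :: "('n \<times> 'n) set \<Rightarrow> (nat \<Rightarrow> ('n \<times> 'n) set) \<Rightarrow> bool" where
  "in_Xi E \<xi> \<longleftrightarrow> (\<forall>l\<ge>1. feasible E (\<xi> l))"

definition Gq :: "('n \<times> 'n) set \<Rightarrow> 'n \<Rightarrow> nat \<Rightarrow> ('n \<times> 'n) set" where
  "Gq E i q = (\<Union>j\<in>Vq E i q. out_edges E j)"

definition r_min :: "real^'n \<Rightarrow> real" where
  "r_min r = Min (range (\<lambda>i. r $ i))"

definition ell_star :: "real^'n \<Rightarrow> nat" where
  "ell_star (r :: real^'n) = CARD('n) * (nat \<lfloor>1 / r_min r\<rfloor> + 1)"

definition sync_string :: "('n \<times> 'n) set \<Rightarrow> real^'n \<Rightarrow> 'n \<Rightarrow> ('n \<times> 'n) set list" where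
  "sync_string E r i = concat (map (\<lambda>q. replicate (ell_star r) (Gq E i q)) [0..<qstar E i])"

definition contains_block :: "(nat \<Rightarrow> 'a) \<Rightarrow> 'a list \<Rightarrow> bool" where
  "contains_block \<xi> s \<longleftrightarrow> (\<exists>m\<ge>1. \<forall>n<length s. \<xi> (m + n) = s ! n)"

definition unit_box :: "(real^'n) set" where
  "unit_box = {\<tau>. \<forall>i. 0 \<le> \<tau> $ i \<and> \<tau> $ i \<le> 1}"

definition D_tau :: "(real^'n) set" where
  "D_tau = {\<tau> \<in> unit_box. Max (range (\<lambda>i. \<tau> $ i)) = 1}"

definition R_set :: "real^'n \<Rightarrow> ('n \<times> 'n) set \<Rightarrow> real^'n \<Rightarrow> 'n \<Rightarrow> 'n \<Rightarrow> real set" where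
  "R_set r El \<tau> i j =
     (if (i, j) \<in> El then
        (if \<tau> $ j < r $ j then {0} else if \<tau> $ j = r $ j then {0, 1} else {1})
      else {\<tau> $ j})"

definition G0 :: "real^'n \<Rightarrow> ('n \<times> 'n) set \<Rightarrow> real^'n \<Rightarrow> (real^'n) set" where
  "G0 r El \<tau> = {g. \<exists>i. \<tau> $ i = 1 \<and> g $ i = 0 \<and> (\<forall>j. j \<noteq> i \<longrightarrow> g $ j \<in> R_set r El \<tau> i j)}"

text \<open>Outer-semicontinuous hull: the map whose graph is the closure of the graph of \<open>G\<^sup>0_\<lambda>\<close>
  (whose domain is \<open>D_\<tau>\<close>).\<close>
definition Gmap :: "real^'n \<Rightarrow> ('n \<times> 'n) set \<Rightarrow> real^'n \<Rightarrow> (real^'n) set" where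
  "Gmap r El \<tau> = {g. (\<tau>, g) \<in> closure {(\<sigma>, h). \<sigma> \<in> D_tau \<and> h \<in> G0 r El \<sigma>}}"

definition compact_htd :: "(real \<times> nat) set \<Rightarrow> bool" where
  "compact_htd S \<longleftrightarrow> (\<exists>J (t :: nat \<Rightarrow> real). t 0 = 0 \<and> (\<forall>j<J. t j \<le> t (Suc j)) \<and>
       S = (\<Union>j<J. {t j .. t (Suc j)} \<times> {j}))"

definition hybrid_time_domain :: "(real \<times> nat) set \<Rightarrow> bool" where
  "hybrid_time_domain S \<longleftrightarrow> S \<subseteq> {0..} \<times> UNIV \<and>
     (\<forall>T J. (T, J) \<in> S \<longrightarrow> compact_htd (S \<inter> ({0..T} \<times> {0..J})))"

definition abs_cont_on :: "real set \<Rightarrow> (real \<Rightarrow> 'a::real_normed_vector) \<Rightarrow> bool" where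
  "abs_cont_on I g \<longleftrightarrow> (\<forall>\<epsilon>>0. \<exists>\<delta>>0. \<forall>n (a :: nat \<Rightarrow> real) b.
      (\<forall>k<n. a k \<in> I \<and> b k \<in> I \<and> a k \<le> b k) \<and> (\<forall>k. Suc k < n \<longrightarrow> b k \<le> a (Suc k)) \<and>
      (\<Sum>k<n. b k - a k) < \<delta> \<longrightarrow> (\<Sum>k<n. norm (g (b k) - g (a k))) < \<epsilon>)"

definition loc_abs_cont_on :: "real set \<Rightarrow> (real \<Rightarrow> 'a::real_normed_vector) \<Rightarrow> bool" where
  "loc_abs_cont_on I g \<longleftrightarrow> (\<forall>a b. {a..b} \<subseteq> I \<longrightarrow> abs_cont_on {a..b} g)"

text \<open>A solution of \<open>\<H>_\<xi>\<close>: a hybrid time domain dm together with the state components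
  \<open>\<tau>\<close> and \<open>\<lambda>\<close> (values outside dm are irrelevant).
  Flow: \<open>\<dot>\<tau> = 1/T \<one>\<close>, \<open>\<dot>\<lambda> = 0\<close>; flow set \<open>C = [0,1]^N \<times> \<nat>\<close>;
  jump set \<open>D = D_\<tau> \<times> \<nat>\<close>; jump map \<open>G_{\<lambda>+1}(\<tau>) \<times> {\<lambda>+1}\<close>.\<close>
definition is_solution ::
  "real \<Rightarrow> real^'n \<Rightarrow> (nat \<Rightarrow> ('n \<times> 'n) set) \<Rightarrow> (real \<times> nat) set \<Rightarrow>
   (real \<Rightarrow> nat \<Rightarrow> real^'n) \<Rightarrow> (real \<Rightarrow> nat \<Rightarrow> nat) \<Rightarrow> bool" where
  "is_solution T r \<xi> dm \<tau> lam \<longleftrightarrow>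
     hybrid_time_domain dm \<and> (0, 0) \<in> dm \<and>
     \<tau> 0 0 \<in> unit_box \<and>
     (\<forall>k. let I = {t. (t, k) \<in> dm} in
        loc_abs_cont_on I (\<lambda>t. \<tau> t k) \<and> loc_abs_cont_on I (\<lambda>t. real (lam t k)) \<and>
        (\<exists>Z. negligible Z \<and> (\<forall>t \<in> I - Z.
            \<tau> t k \<in> unit_box \<and>
            ((\<lambda>s. \<tau> s k) has_vector_derivative ((1 / T) *\<^sub>R (\<chi> i. 1))) (at t within I) \<and>
            ((\<lambda>s. real (lam s k)) has_vector_derivative 0) (at t within I)))) \<and>
     (\<forall>t k. (t, k) \<in> dm \<and> (t, Suc k) \<in> dm \<longrightarrow>
        \<tau> t k \<in> D_tau \<and>
        \<tau> t (Suc k) \<in> Gmap r (\<xi> (lam t k + 1)) (\<tau> t k) \<and>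
        lam t (Suc k) = lam t k + 1)"

definition is_maximal_solution ::
  "real \<Rightarrow> real^'n \<Rightarrow> (nat \<Rightarrow> ('n \<times> 'n) set) \<Rightarrow> (real \<times> nat) set \<Rightarrow>
   (real \<Rightarrow> nat \<Rightarrow> real^'n) \<Rightarrow> (real \<Rightarrow> nat \<Rightarrow> nat) \<Rightarrow> bool" where
  "is_maximal_solution T r \<xi> dm \<tau> lam \<longleftrightarrow>
     is_solution T r \<xi> dm \<tau> lam \<and>
     \<not> (\<exists>dm' \<tau>' lam'. is_solution T r \<xi> dm' \<tau>' lam' \<and> dm \<subset> dm' \<and>
          (\<forall>(t, k) \<in> dm. \<tau>' t k = \<tau> t k \<and> lam' t k = lam t k))"

definition A_s :: "(real^'n) set" where
  "A_s = {\<mu> *\<^sub>R (\<chi> i. 1) | \<mu>. 0 \<le> \<mu> \<and> \<mu> \<le> 1} \<union> {\<tau>. \<forall>i. \<tau> $ i = 0 \<or> \<tau> $ i = 1}"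

end

theory Submission
  imports Defs
begin

text \<open>Fix the root \<open>c\<close> of the synchronization string and call an agent synced if its state agrees with
  that of \<open>c\<close>, or if both states lie in \<open>{0, 1}\<close>. A state is in \<open>A_s\<close> iff all agents are synced.
  Flows preserve this relation, and so do jumps whose graph only has edges leaving synced agents:
  if a synced agent fires, then \<open>c\<close> and all other synced agents are in \<open>{0, 1}\<close> and stay there, and
  so do the out-neighbours of the firing agent. During the block of the graphs
  \<open>\<G>\<^sub>q\<close> the sources are the vertices at distance \<open>q\<close>, which are already synced. Until such a vertex
  \<open>v\<close> fires, every other agent fires at most twice, so \<open>v\<close> fires within \<open>2N \<le> \<ell>\<^sup>*\<close> jumps
  and syncs its out-neighbours. Thus everything is synced after the string. Maximal solutions do
  reach the end of the string, with at most time \<open>T\<close> between jumps: a solution that stops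
  jumping can be extended by flowing until some component is \<open>1\<close> and then jumping.\<close>

subsection \<open>Absolutely continuous functions with constant derivative\<close>

text \<open>Later applied to both \<open>\<tau>\<close> and \<open>lam\<close>: it turns the
  almost-everywhere flow equation into exact affine motion. The deviation \<open>h\<close> from
  affinity is subadditive over adjacent intervals, so local estimates can be summed.\<close>

lemma abs_cont_linear:
  fixes f :: "real \<Rightarrow> 'a::real_normed_vector"
  assumes "a \<le> b" and ac: "abs_cont_on {a..b} f" and "negligible Z"
    and der: "\<And>t. t \<in> {a..b} - Z \<Longrightarrow> (f has_vector_derivative c) (at t within {a..b})"
  shows "f b - f a = (b - a) *\<^sub>R c"
proof -
  define h where "h u v = norm (f v - f u - (v - u) *\<^sub>R c)" for u v
  have h_trans: "h u w \<le> h u v + h v w" for u v w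
  proof -
    have "f w - f u - (w - u) *\<^sub>R c = (f v - f u - (v - u) *\<^sub>R c) + (f w - f v - (w - v) *\<^sub>R c)"
      by (simp add: algebra_simps)
    then show ?thesis
      unfolding h_def by (metis norm_triangle_ineq)
  qed
  \<comment> \<open>Cousin-style covering argument: small intervals around a point outside \<open>Z\<close> contribute at most
    \<open>e\<close> times their length; the others are collected in \<open>L\<close> and lie in an open set of measure
    below \<open>min \<delta> e\<close>, where absolute continuity applies.\<close>
  have bound: "h a b \<le> e * (b - a + 1 + norm c)" if "e > 0" for e
  proof -
    obtain \<delta> where "\<delta> > 0" and \<delta>: "\<forall>n (p :: nat \<Rightarrow> real) q.
      (\<forall>k<n. p k \<in> {a..b} \<and> q k \<in> {a..b} \<and> p k \<le> q k) \<and> (\<forall>k. Suc k < n \<longrightarrow> q k \<le> p (Suc k)) \<and>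
      (\<Sum>k<n. q k - p k) < \<delta> \<longrightarrow> (\<Sum>k<n. norm (f (q k) - f (p k))) < e"
      using ac \<open>e > 0\<close> unfolding abs_cont_on_def by blast
    have "Z \<in> sets lebesgue"
      using \<open>negligible Z\<close> negligible_iff_measure by blast
    moreover have "0 < min \<delta> e"
      using \<open>\<delta> > 0\<close> \<open>e > 0\<close> by simp
    ultimately obtain U where U: "open U" "Z \<subseteq> U" "U - Z \<in> lmeasurable"
      "emeasure lebesgue (U - Z) < ennreal (min \<delta> e)"
      by (rule sets_lebesgue_outer_open)
    have U_meas: "U \<in> lmeasurable"
      using U \<open>negligible Z\<close>
      by (metis Diff_partition fmeasurable.Un negligible_iff_measure)
    have "measure lebesgue U = measure lebesgue (U - Z)"
      using \<open>negligible Z\<close> measure_Diff_null_set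
      by (metis U_meas fmeasurableD negligible_iff_null_sets)
    also have "\<dots> < min \<delta> e"
      using U(3,4) \<open>0 < min \<delta> e\<close>
      by (simp add: emeasure_eq_measure2 ennreal_less_iff)
    finally have U_small: "measure lebesgue U < min \<delta> e" .
    \<comment> \<open>Increments of \<open>m\<close> are additive over adjacent intervals, so they
      provide a length budget for \<open>L\<close> that survives concatenation of lists.\<close>
    define m where "m x = measure lebesgue (U \<inter> {a..x})" for x
    have m_diff: "m v - m u = measure lebesgue (U \<inter> {u<..v})" if "a \<le> u" "u \<le> v" for u v
    proof -
      have "m v = measure lebesgue ((U \<inter> {a..u}) \<union> (U \<inter> {u<..v}))"
        unfolding m_def using that by (intro arg_cong[where f="measure lebesgue"]) auto
      also have "\<dots> = m u + measure lebesgue (U \<inter> {u<..v})"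
      proof -
        have disj: "(U \<inter> {a..u}) \<inter> (U \<inter> {u<..v}) = {}"
          by auto
        have "U \<inter> {a..u} \<in> lmeasurable" "U \<inter> {u<..v} \<in> lmeasurable"
          using U_meas by (auto intro!: fmeasurable_Int_fmeasurable)
        then show ?thesis
          unfolding m_def by (simp add: measure_Un3 disj)
      qed
      finally show ?thesis by simp
    qed
    \<comment> \<open>Bisection also tests small intervals around an endpoint that stick out of
      \<open>{a..b}\<close>; the guard makes \<open>P\<close> vacuous there.\<close>
    define P where "P u v \<longleftrightarrow> (a \<le> u \<and> v \<le> b \<longrightarrow> (\<exists>L.
        (\<forall>p\<in>set L. u \<le> fst p \<and> fst p \<le> snd p \<and> snd p \<le> v) \<and>
        sorted_wrt (\<lambda>p q. snd p \<le> fst q) L \<and>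
        (\<Sum>p\<leftarrow>L. snd p - fst p) \<le> m v - m u \<and>
        h u v \<le> e * (v - u) + (\<Sum>p\<leftarrow>L. h (fst p) (snd p))))" for u v
    have "P a b"
      using \<open>a \<le> b\<close>
    proof (induction rule: Bolzano)
      case (trans u v w)
      show ?case
        unfolding P_def
      proof
        assume uw: "a \<le> u \<and> w \<le> b"
        obtain L where L: "\<forall>p\<in>set L. u \<le> fst p \<and> fst p \<le> snd p \<and> snd p \<le> v"
          "sorted_wrt (\<lambda>p q. snd p \<le> fst q) L" "(\<Sum>p\<leftarrow>L. snd p - fst p) \<le> m v - m u"
          "h u v \<le> e * (v - u) + (\<Sum>p\<leftarrow>L. h (fst p) (snd p))"
          using trans uw unfolding P_def by (meson order_trans)
        obtain M where M: "\<forall>p\<in>set M. v \<le> fst p \<and> fst p \<le> snd p \<and> snd p \<le> w"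
          "sorted_wrt (\<lambda>p q. snd p \<le> fst q) M" "(\<Sum>p\<leftarrow>M. snd p - fst p) \<le> m w - m v"
          "h v w \<le> e * (w - v) + (\<Sum>p\<leftarrow>M. h (fst p) (snd p))"
          using trans uw unfolding P_def by (meson order_trans)
        have "e * (w - u) = e * (v - u) + e * (w - v)"
          by (simp add: algebra_simps)
        then have "h u w \<le> e * (w - u) + (\<Sum>p\<leftarrow>L @ M. h (fst p) (snd p))"
          using L(4) M(4) h_trans[of u w v] by simp
        moreover have "\<forall>p\<in>set (L @ M). u \<le> fst p \<and> fst p \<le> snd p \<and> snd p \<le> w"
          using L(1) M(1) trans by fastforce
        moreover have "sorted_wrt (\<lambda>p q. snd p \<le> fst q) (L @ M)"
          using L(1,2) M(1,2) by (fastforce simp: sorted_wrt_append)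
        moreover have "(\<Sum>p\<leftarrow>L @ M. snd p - fst p) \<le> m w - m u"
          using L(3) M(3) by simp
        ultimately show "\<exists>L. (\<forall>p\<in>set L. u \<le> fst p \<and> fst p \<le> snd p \<and> snd p \<le> w) \<and>
          sorted_wrt (\<lambda>p q. snd p \<le> fst q) L \<and> (\<Sum>p\<leftarrow>L. snd p - fst p) \<le> m w - m u \<and>
          h u w \<le> e * (w - u) + (\<Sum>p\<leftarrow>L. h (fst p) (snd p))"
          by blast
      qed
    next
      case (local x)
      show ?case
      proof (cases "x \<in> Z")
        case True
        then obtain d where "d > 0" and d: "ball x d \<subseteq> U"
          using U(1,2) openE by (metis subsetD)
        have "P u v" if uv: "u \<le> x \<and> x \<le> v \<and> v - u < d" for u v
          unfolding P_def
        proof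
          assume "a \<le> u \<and> v \<le> b"
          have "{u<..v} \<subseteq> ball x d"
            using uv by (auto simp: dist_real_def)
          then have "U \<inter> {u<..v} = {u<..v}"
            using d by blast
          then have "m v - m u = v - u"
            using m_diff[of u v] \<open>a \<le> u \<and> v \<le> b\<close> uv by (simp add: measure_completion)
          then show "\<exists>L. (\<forall>p\<in>set L. u \<le> fst p \<and> fst p \<le> snd p \<and> snd p \<le> v) \<and>
            sorted_wrt (\<lambda>p q. snd p \<le> fst q) L \<and> (\<Sum>p\<leftarrow>L. snd p - fst p) \<le> m v - m u \<and>
            h u v \<le> e * (v - u) + (\<Sum>p\<leftarrow>L. h (fst p) (snd p))"
            using uv \<open>e > 0\<close> by (intro exI[of _ "[(u, v)]"]) auto
        qed
        then show ?thesis
          using \<open>d > 0\<close> by blast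
      next
        case False
        then have "(f has_derivative (\<lambda>t. t *\<^sub>R c)) (at x within {a..b})"
          using der local unfolding has_vector_derivative_def by simp
        then obtain d where "d > 0"
          and d: "\<And>y. y \<in> {a..b} \<Longrightarrow> norm (y - x) < d \<Longrightarrow>
            norm (f y - f x - (y - x) *\<^sub>R c) \<le> e * norm (y - x)"
          unfolding has_derivative_within_alt using \<open>e > 0\<close> by blast
        have "P u v" if uv: "u \<le> x \<and> x \<le> v \<and> v - u < d" for u v
          unfolding P_def
        proof
          assume ab: "a \<le> u \<and> v \<le> b"
          have "h x v \<le> e * (v - x)"
            using d[of v] uv ab local unfolding h_def by simp
          moreover have "h u x \<le> e * (x - u)"
          proof -
            have "h u x = norm (f u - f x - (u - x) *\<^sub>R c)"
              unfolding h_def by (subst norm_minus_cancel[symmetric]) (simp add: algebra_simps)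
            then show ?thesis
              using d[of u] uv ab local by simp
          qed
          ultimately have "h u v \<le> e * (v - u)"
            using h_trans[of u v x] by (simp add: algebra_simps)
          moreover have "0 \<le> m v - m u"
            using m_diff[of u v] ab uv by simp
          ultimately show "\<exists>L. (\<forall>p\<in>set L. u \<le> fst p \<and> fst p \<le> snd p \<and> snd p \<le> v) \<and>
            sorted_wrt (\<lambda>p q. snd p \<le> fst q) L \<and> (\<Sum>p\<leftarrow>L. snd p - fst p) \<le> m v - m u \<and>
            h u v \<le> e * (v - u) + (\<Sum>p\<leftarrow>L. h (fst p) (snd p))"
            by (intro exI[of _ "[]"]) auto
        qed
        then show ?thesis
          using \<open>d > 0\<close> by blast
      qed
    qed
    then obtain L where L: "\<forall>p\<in>set L. a \<le> fst p \<and> fst p \<le> snd p \<and> snd p \<le> b"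
      "sorted_wrt (\<lambda>p q. snd p \<le> fst q) L" "(\<Sum>p\<leftarrow>L. snd p - fst p) \<le> m b - m a"
      "h a b \<le> e * (b - a) + (\<Sum>p\<leftarrow>L. h (fst p) (snd p))"
      unfolding P_def by auto
    have "m b - m a \<le> measure lebesgue U"
      using m_diff[of a b] \<open>a \<le> b\<close> U_meas
      by (simp add: measure_mono_fmeasurable[OF _ _ U_meas] sets.Int fmeasurableD)
    then have len: "(\<Sum>p\<leftarrow>L. snd p - fst p) < min \<delta> e"
      using L(3) U_small by linarith
    have "(\<Sum>k<length L. norm (f (snd (L ! k)) - f (fst (L ! k)))) < e"
    proof (intro \<delta>[rule_format] conjI allI impI)
      show "(\<Sum>k<length L. snd (L ! k) - fst (L ! k)) < \<delta>"
        using len by (simp add: sum_list_sum_nth atLeast0LessThan)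
      show "snd (L ! k) \<le> fst (L ! Suc k)" if "Suc k < length L" for k
        using L(2) that by (simp add: sorted_wrt_iff_nth_less)
    qed (use L(1) in \<open>auto intro: order_trans dest!: nth_mem\<close>)
    then have 1: "(\<Sum>p\<leftarrow>L. norm (f (snd p) - f (fst p))) < e"
      by (simp add: sum_list_sum_nth atLeast0LessThan)
    \<comment> \<open>This is where both halves of \<open>min \<delta> e\<close> are used:
      \<open>\<delta>\<close> makes the increments of \<open>f\<close> small, and the bound
      \<open>e\<close> on the total length makes the linear part small.\<close>
    have "(\<Sum>p\<leftarrow>L. h (fst p) (snd p))
        \<le> (\<Sum>p\<leftarrow>L. norm (f (snd p) - f (fst p)) + (snd p - fst p) * norm c)"
    proof (rule sum_list_mono)
      fix p assume "p \<in> set L"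
      then have "norm ((snd p - fst p) *\<^sub>R c) = (snd p - fst p) * norm c"
        using L(1) by simp
      then show "h (fst p) (snd p) \<le> norm (f (snd p) - f (fst p)) + (snd p - fst p) * norm c"
        unfolding h_def by (metis norm_triangle_ineq4)
    qed
    also have "\<dots> = (\<Sum>p\<leftarrow>L. norm (f (snd p) - f (fst p))) + (\<Sum>p\<leftarrow>L. snd p - fst p) * norm c"
      by (simp add: sum_list_addf sum_list_mult_const)
    also have "\<dots> \<le> e + e * norm c"
      using 1 len by (intro add_mono mult_right_mono) auto
    finally show ?thesis
      using L(4) by (simp add: algebra_simps)
  qed
  have "h a b \<le> 0 + e" if "e > 0" for e
  proof -
    have pos: "0 < b - a + 1 + norm c"
      using \<open>a \<le> b\<close> norm_ge_zero[of c] by linarith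
    then show ?thesis
      using bound[of "e / (b - a + 1 + norm c)"] that by simp
  qed
  then have "h a b \<le> 0"
    by (rule field_le_epsilon)
  then show ?thesis
    unfolding h_def by simp
qed

subsection \<open>Synced agents\<close>

definition synced :: "'n \<Rightarrow> real^'n \<Rightarrow> 'n \<Rightarrow> bool" where
  "synced c x j \<longleftrightarrow> x $ j = x $ c \<or> (x $ j \<in> {0, 1} \<and> x $ c \<in> {0, 1})"

text \<open>The state of \<open>c\<close> decides which half of \<open>A_s\<close> is meant: if it
  lies in \<open>{0, 1}\<close>, so do all others; otherwise all agents share its value.\<close>

lemma A_s_iff_synced:
  assumes "x \<in> unit_box"
  shows "x \<in> A_s \<longleftrightarrow> (\<forall>j. synced c x j)"
proof
  assume "x \<in> A_s"
  then show "\<forall>j. synced c x j"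
    by (auto simp: A_s_def synced_def)
next
  assume sync: "\<forall>j. synced c x j"
  show "x \<in> A_s"
  proof (cases "x $ c \<in> {0, 1}")
    case True
    then have "\<forall>j. x $ j = 0 \<or> x $ j = 1"
      using sync unfolding synced_def by fastforce
    then show ?thesis
      by (simp add: A_s_def)
  next
    case False
    then have "x $ j = x $ c" for j
      using sync unfolding synced_def by blast
    then have "x = x $ c *\<^sub>R (\<chi> i. 1)"
      unfolding vec_eq_iff by (metis mult.right_neutral vec_lambda_beta vector_scaleR_component real_scaleR_def)
    moreover have "0 \<le> x $ c" "x $ c \<le> 1"
      using assms by (auto simp: unit_box_def)
    ultimately show ?thesis
      unfolding A_s_def by blast
  qed
qed

text \<open>Two distinct states in \<open>{0, 1}\<close> include a 1, and a component at 1 cannot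
  rise inside the box, so \<open>d = 0\<close>. Equal states simply move together.\<close>

lemma synced_flow:
  assumes "synced c x j" "x \<in> unit_box" "y \<in> unit_box" "0 \<le> d" "y = x + d *\<^sub>R (\<chi> i. 1)"
  shows "synced c y j"
proof (cases "x $ j = x $ c")
  case False
  then have "x $ j = 1 \<or> x $ c = 1" "x $ j \<in> {0, 1}" "x $ c \<in> {0, 1}"
    using assms(1) by (auto simp: synced_def)
  moreover have "y $ j \<le> 1" "y $ c \<le> 1"
    using assms(3) by (auto simp: unit_box_def)
  ultimately have "d = 0"
    using assms(4,5) by auto
  then show ?thesis
    using assms(1,5) by simp
qed (simp add: synced_def assms(5))

text \<open>\<open>G0\<close> with the firing agent made explicit, since the counting argument has
  to know who fires.\<close>

definition fires :: "real^'n \<Rightarrow> ('n \<times> 'n) set \<Rightarrow> real^'n \<Rightarrow> 'n \<Rightarrow> real^'n \<Rightarrow> bool" where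
  "fires r El x i g \<longleftrightarrow> x $ i = 1 \<and> g $ i = 0 \<and> (\<forall>j. j \<noteq> i \<longrightarrow> g $ j \<in> R_set r El x i j)"

lemma G0_iff_fires: "g \<in> G0 r El x \<longleftrightarrow> (\<exists>i. fires r El x i g)"
  by (simp add: G0_def fires_def)

lemma fires_cases:
  assumes "fires r El x i g"
  shows "g $ j \<in> {0, 1} \<or> (j \<noteq> i \<and> (i, j) \<notin> El \<and> g $ j = x $ j)"
proof (cases "j = i")
  case False
  then have "g $ j \<in> R_set r El x i j"
    using assms by (simp add: fires_def)
  then show ?thesis
    using False by (auto simp: R_set_def split: if_splits)
qed (use assms in \<open>simp add: fires_def\<close>)

lemma fires_edge:
  assumes "fires r El x i g" "(i, j) \<in> El"
  shows "g $ j \<in> {0, 1}"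
  using fires_cases[OF assms(1), of j] assms(2) by auto

lemma fires_bool:
  assumes "fires r El x i g" "x $ j \<in> {0, 1}"
  shows "g $ j \<in> {0, 1}"
  using fires_cases[OF assms(1), of j] assms(2) by auto

lemma fires_in_box:
  assumes "fires r El x i g" "x \<in> unit_box"
  shows "g \<in> unit_box"
  unfolding unit_box_def
proof safe
  fix j
  have "g $ j \<in> {0, 1} \<or> g $ j = x $ j"
    using fires_cases[OF assms(1), of j] by blast
  then show "0 \<le> g $ j" "g $ j \<le> 1"
    using assms(2) unfolding unit_box_def by auto
qed

text \<open>If \<open>c\<close> is strictly between 0 and 1, the firing agent is not synced, hence
  not the source of any edge, and no other agent changes. Otherwise \<open>c\<close> and
  \<open>j\<close> are in \<open>{0, 1}\<close> and remain there.\<close>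

lemma synced_fires:
  assumes f: "fires r El x i g" and src: "\<forall>a\<in>Domain El. synced c x a"
    and j: "synced c x j"
  shows "synced c g j"
proof (cases "x $ c \<in> {0, 1}")
  case True
  then have "x $ j \<in> {0, 1}"
    using j unfolding synced_def by auto
  then show ?thesis
    using True fires_bool[OF f] unfolding synced_def by blast
next
  case False
  have "x $ i = 1"
    using f unfolding fires_def by simp
  then have "\<not> synced c x i"
    using False unfolding synced_def by auto
  then have "(i, j) \<notin> El" "(i, c) \<notin> El" "j \<noteq> i" "c \<noteq> i"
    using src j by (auto simp: synced_def)
  then have "g $ j = x $ j" "g $ c = x $ c"
    using f unfolding fires_def R_set_def by auto
  then show ?thesis
    using j by (simp add: synced_def)
qed

text \<open>A synced agent at 1 forces \<open>c\<close> into \<open>{0, 1}\<close>, which is also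
  where the pulse sends the receiver.\<close>

lemma synced_out_neighbour:
  assumes f: "fires r El x i g" and "(i, j) \<in> El" and i: "synced c x i"
  shows "synced c g j"
proof -
  have "x $ c \<in> {0, 1}"
    using f i unfolding fires_def synced_def by auto
  then show ?thesis
    using fires_bool[OF f] fires_edge[OF f assms(2)] unfolding synced_def by blast
qed

text \<open>An upper bound for the number of times agent \<open>w\<close> can still fire before \<open>v\<close> does,
  valid while all agents that send pulses are synced with \<open>v\<close>.\<close>

definition shots :: "'n \<Rightarrow> real^'n \<Rightarrow> 'n \<Rightarrow> nat" where
  "shots v x w = (if x $ w > x $ v then 2 else if x $ v = 1 \<and> x $ w = 0 then 0 else 1)"

text \<open>Flowing preserves the comparison of \<open>w\<close> with \<open>v\<close>. The value 0
  cannot increase, because \<open>v\<close> at 1 leaves no room to flow.\<close>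

lemma shots_flow:
  assumes "y \<in> unit_box" "0 \<le> d" "y = x + d *\<^sub>R (\<chi> i. 1)"
  shows "shots v y w \<le> shots v x w"
proof -
  have "y $ v \<le> 1"
    using assms(1) by (simp add: unit_box_def)
  then show ?thesis
    using assms(2,3) by (auto simp: shots_def)
qed

text \<open>A pulse reaching \<open>v\<close> comes from a synced agent at 1, so \<open>v\<close> is
  at 0 or 1. Both are fixed by the reset because the threshold lies strictly between them.\<close>

lemma fires_unfired_source:
  assumes f: "fires r El x i g" and r: "\<forall>i. 0 < r $ i \<and> r $ i < 1"
    and src: "\<forall>a\<in>Domain El. synced c x a" and v: "synced c x v" and "v \<noteq> i"
  shows "g $ v = x $ v"
proof (cases "(i, v) \<in> El")
  case True
  then have "synced c x i" "x $ i = 1"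
    using src f by (auto simp: fires_def)
  then have "x $ v \<in> {0, 1}"
    using v by (auto simp: synced_def)
  moreover have "g $ v \<in> R_set r El x i v"
    using f \<open>v \<noteq> i\<close> by (simp add: fires_def)
  ultimately show ?thesis
    using True r[rule_format, of v] by (auto simp: R_set_def)
qed (use f \<open>v \<noteq> i\<close> in \<open>auto simp: fires_def R_set_def\<close>)

text \<open>The firing agent falls from 1 to 0 and pays one unit: from 2 to 1 if
  \<open>x $ v < 1\<close>, from 1 to 0 if \<open>x $ v = 1\<close>. Pulses move other agents only
  when \<open>v\<close> is at 0 or 1, and they leave agents at 0 where they are, so no count
  grows.\<close>

lemma shots_fires:
  assumes f: "fires r El x i g" and r: "\<forall>i. 0 < r $ i \<and> r $ i < 1" and box: "x \<in> unit_box"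
    and src: "\<forall>a\<in>Domain El. synced c x a" and v: "synced c x v" and "v \<noteq> i"
  shows "shots v g w + (if w = i then 1 else 0) \<le> shots v x w"
proof -
  have gv: "g $ v = x $ v"
    using fires_unfired_source[OF f r src v \<open>v \<noteq> i\<close>] by blast
  have bx: "0 \<le> x $ w" "x $ w \<le> 1" "0 \<le> x $ v" "x $ v \<le> 1"
    using box by (auto simp: unit_box_def)
  have xi: "x $ i = 1" "g $ i = 0"
    using f by (auto simp: fires_def)
  show ?thesis
  proof (cases "w = i")
    case True
    then show ?thesis
      using gv xi bx by (auto simp: shots_def)
  next
    case False
    show ?thesis
    proof (cases "(i, w) \<in> El")
      case True
      then have "synced c x i"
        using src by blast
      then have "x $ v \<in> {0, 1}"
        using v xi by (auto simp: synced_def)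
      moreover have "x $ w > 0 \<or> x $ w = 0"
        using bx by linarith
      moreover have "x $ w = 0 \<Longrightarrow> g $ w = 0"
        using f r[rule_format, of w] False True by (auto simp: fires_def R_set_def)
      moreover have "g $ w \<in> {0, 1}"
        using fires_edge[OF f True] .
      ultimately show ?thesis
        using gv bx False by (auto simp: shots_def)
    next
      case False
      then have "g $ w = x $ w"
        using f \<open>w \<noteq> i\<close> by (auto simp: fires_def R_set_def)
      then show ?thesis
        using gv \<open>w \<noteq> i\<close> by (simp add: shots_def)
    qed
  qed
qed

text \<open>Thresholds below 1 make the floor in \<open>ell_star\<close> at least 1.\<close>

lemma two_card_le_ell_star:
  assumes r: "\<forall>i. 0 < r $ i \<and> r $ i < 1"
  shows "2 * CARD('n) \<le> ell_star (r :: real^'n)"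
proof -
  have "r_min r \<in> range (\<lambda>i. r $ i)"
    unfolding r_min_def by (rule Min_in) auto
  then have "0 < r_min r" "r_min r < 1"
    using r by auto
  then have "1 \<le> \<lfloor>1 / r_min r\<rfloor>"
    by (simp add: le_floor_iff)
  then have "2 \<le> nat \<lfloor>1 / r_min r\<rfloor> + 1"
    by linarith
  then show ?thesis
    unfolding ell_star_def by (metis mult.commute mult_le_mono2)
qed

subsection \<open>Jump sequences\<close>

text \<open>A solution sampled at its jumps: \<open>s k\<close> is the state before jump
  \<open>k\<close>, \<open>i k\<close> the agent that fires, \<open>g k\<close> the state after it,
  and \<open>d k\<close> the rise of all components until the next jump. Jumps are counted from 0
  and graphs from 1, hence \<open>\<xi> (Suc k)\<close>.\<close>

locale jump_chain =
  fixes r :: "real^'n" and \<xi> :: "nat \<Rightarrow> ('n \<times> 'n) set" and s g :: "nat \<Rightarrow> real^'n"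
    and i :: "nat \<Rightarrow> 'n" and d :: "nat \<Rightarrow> real"
  assumes r: "\<forall>j. 0 < r $ j \<and> r $ j < 1"
    and box: "\<And>k. s k \<in> unit_box"
    and fire: "\<And>k. fires r (\<xi> (Suc k)) (s k) (i k) (g k)"
    and flow: "\<And>k. s (Suc k) = g k + d k *\<^sub>R (\<chi> i. 1)" and d: "\<And>k. 0 \<le> d k"
begin

lemma synced_step:
  assumes "\<forall>a\<in>Domain (\<xi> (Suc k)). synced c (s k) a" "synced c (s k) j"
  shows "synced c (s (Suc k)) j"
proof -
  have "synced c (g k) j"
    using fire[of k] assms by (rule synced_fires)
  moreover have "g k \<in> unit_box"
    using fire[of k] box[of k] by (rule fires_in_box)
  ultimately show ?thesis
    using box[of "Suc k"] d[of k] flow[of k] by (rule synced_flow)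
qed

lemma synced_constant_graph:
  assumes F: "\<And>n. n < l \<Longrightarrow> \<xi> (Suc (k + n)) = F"
    and src: "\<forall>a\<in>Domain F. synced c (s k) a" and j: "synced c (s k) j" and "n \<le> l"
  shows "synced c (s (k + n)) j"
proof -
  \<comment> \<open>All agents are treated at once because the induction step needs the sources to
    be synced still.\<close>
  have "n \<le> l \<Longrightarrow> \<forall>j. synced c (s k) j \<longrightarrow> synced c (s (k + n)) j" for n
  proof (induction n)
    case (Suc n)
    have "\<xi> (Suc (k + n)) = F"
      using F Suc.prems by simp
    moreover have sync: "synced c (s (k + n)) j" if "synced c (s k) j" for j
      using Suc.IH Suc.prems that by fastforce
    ultimately have "\<forall>a\<in>Domain (\<xi> (Suc (k + n))). synced c (s (k + n)) a"
      using src by simp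
    then show ?case
      unfolding add_Suc_right using synced_step sync by blast
  qed simp
  then show ?thesis
    using j \<open>n \<le> l\<close> by blast
qed

lemma ex_fires_constant_graph:
  assumes F: "\<And>n. n < l \<Longrightarrow> \<xi> (Suc (k + n)) = F" and l: "2 * CARD('n) \<le> l"
    and src: "\<forall>a\<in>Domain F. synced c (s k) a" and v: "synced c (s k) v"
  shows "\<exists>n<l. i (k + n) = v"
proof (rule ccontr)
  assume nofire: "\<not> ?thesis"
  \<comment> \<open>The total starts at no more than \<open>2 * (CARD('n) - 1)\<close> and drops at
    every jump that is not a firing of \<open>v\<close>, so \<open>l\<close> such jumps are too
    many.\<close>
  define \<Phi> where "\<Phi> n = (\<Sum>w\<in>UNIV - {v}. shots v (s (k + n)) w)" for n
  have dec: "\<Phi> (Suc n) < \<Phi> n" if "n < l" for n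
  proof -
    have iv: "v \<noteq> i (k + n)"
      using nofire that by auto
    have sync: "synced c (s (k + n)) j" if "synced c (s k) j" for j
      by (rule synced_constant_graph[OF F src that less_imp_le[OF \<open>n < l\<close>]])
    have le: "shots v (s (k + Suc n)) w + (if w = i (k + n) then 1 else 0)
      \<le> shots v (s (k + n)) w" for w
    proof -
      have "shots v (s (k + Suc n)) w \<le> shots v (g (k + n)) w"
        unfolding add_Suc_right by (rule shots_flow[OF box d flow])
      moreover have "shots v (g (k + n)) w + (if w = i (k + n) then 1 else 0)
          \<le> shots v (s (k + n)) w"
      proof (rule shots_fires[OF fire r box _ sync[OF v] iv])
        show "\<forall>a\<in>Domain (\<xi> (Suc (k + n))). synced c (s (k + n)) a"
          unfolding F[OF \<open>n < l\<close>] using sync src by simp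
      qed
      ultimately show ?thesis by linarith
    qed
    show ?thesis
      unfolding \<Phi>_def
    proof (rule sum_strict_mono_ex1)
      show "\<forall>w\<in>UNIV - {v}. shots v (s (k + Suc n)) w \<le> shots v (s (k + n)) w"
      proof
        show "shots v (s (k + Suc n)) w \<le> shots v (s (k + n)) w" for w
          using le[of w] by (rule add_leD1)
      qed
      show "\<exists>w\<in>UNIV - {v}. shots v (s (k + Suc n)) w < shots v (s (k + n)) w"
      proof
        show "shots v (s (k + Suc n)) (i (k + n)) < shots v (s (k + n)) (i (k + n))"
          using le[of "i (k + n)"] by simp
      qed (use iv in simp)
    qed simp
  qed
  have "\<Phi> n + n \<le> \<Phi> 0" if "n \<le> l" for n
    using that
  proof (induction n)
    case (Suc n)
    then show ?case
      using dec[of n] by simp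
  qed simp
  from this[of l] have "l \<le> \<Phi> 0"
    by simp
  also have "\<dots> \<le> (\<Sum>w\<in>UNIV - {v}. 2)"
    unfolding \<Phi>_def by (intro sum_mono) (simp add: shots_def)
  also have "\<dots> < 2 * CARD('n)"
    by (simp add: card_Diff_singleton)
  finally show False
    using l by simp
qed

end

subsection \<open>The synchronization string\<close>

lemma root_ex_path:
  assumes "is_root E c"
  shows "\<exists>p. path_from_to E c j p"
proof (cases "j = c")
  case True
  then have "path_from_to E c j [c]"
    by (simp add: path_from_to_def is_path_def)
  then show ?thesis ..
qed (use assms in \<open>simp add: is_root_def\<close>)

lemma root_in_Vq: "is_root E c \<Longrightarrow> j \<in> Vq E c (sp_dist E c j)"
  by (simp add: Vq_def root_ex_path)

lemma sp_dist_le: "path_from_to E c j p \<Longrightarrow> sp_dist E c j \<le> path_length p"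
  unfolding sp_dist_def by (rule Least_le) blast

text \<open>Removing the last vertex of a shortest path to \<open>j\<close> leaves a shorter path to
  an in-neighbour of \<open>j\<close>.\<close>

lemma ex_predecessor:
  assumes "is_root E c" "j \<noteq> c"
  shows "\<exists>v. (v, j) \<in> E \<and> sp_dist E c v < sp_dist E c j"
proof -
  have "\<exists>q p. path_from_to E c j p \<and> path_length p = q"
    using root_ex_path[OF assms(1)] by blast
  then have "\<exists>p. path_from_to E c j p \<and> path_length p = sp_dist E c j"
    unfolding sp_dist_def by (rule LeastI_ex)
  then obtain p where p: "path_from_to E c j p" "path_length p = sp_dist E c j"
    by blast
  have path: "p \<noteq> []" "distinct p" "hd p = c" "last p = j"
    and edge: "\<And>k. Suc k < length p \<Longrightarrow> (p ! k, p ! Suc k) \<in> E"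
    using p(1) unfolding path_from_to_def is_path_def by auto
  define q where "q = butlast p"
  have pq: "p = q @ [j]"
    using path unfolding q_def by (metis append_butlast_last_id)
  then have "q \<noteq> []"
    using path assms(2) by auto
  then have last: "last q = p ! (length q - 1)" "p ! Suc (length q - 1) = j"
    unfolding pq by (simp_all add: last_conv_nth nth_append)
  have "(last q, j) \<in> E"
    using edge[of "length q - 1"] \<open>q \<noteq> []\<close> last pq by simp
  moreover have "(q ! k, q ! Suc k) \<in> E" if "Suc k < length q" for k
    using edge[of k] that unfolding pq by (simp add: nth_append)
  then have "path_from_to E c (last q) q"
    using path \<open>q \<noteq> []\<close> unfolding path_from_to_def is_path_def pq by auto
  then have "sp_dist E c (last q) < sp_dist E c j"
    using sp_dist_le p(2) \<open>q \<noteq> []\<close> pq unfolding path_length_def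
    by (metis One_nat_def Suc_pred diff_Suc_1 length_append_singleton length_greater_0_conv less_Suc_eq_le)
  ultimately show ?thesis
    by blast
qed

lemma sp_dist_le_qstar:
  fixes E :: "('n::finite \<times> 'n) set"
  assumes "is_root E c"
  shows "sp_dist E c j \<le> qstar E c"
proof -
  have "{q. Vq E c q \<noteq> {}} \<subseteq> range (sp_dist E c)"
    by (auto simp: Vq_def)
  then have "finite {q. Vq E c q \<noteq> {}}"
    by (rule finite_subset) simp
  then show ?thesis
    unfolding qstar_def using root_in_Vq[OF assms] by (intro Max_ge) auto
qed

lemma Gq_iff: "(v, w) \<in> Gq E c q \<longleftrightarrow> v \<in> Vq E c q \<and> (v, w) \<in> E"
  by (auto simp: Gq_def out_edges_def)

lemma length_concat_replicate: "length (concat (map (\<lambda>q. replicate l (f q)) [0..<Q])) = Q * l"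
  by (induction Q) auto

lemma nth_concat_replicate:
  assumes "q < Q" "n < l"
  shows "concat (map (\<lambda>q. replicate l (f q)) [0..<Q]) ! (q * l + n) = f q"
  using assms(1)
proof (induction Q)
  case (Suc Q)
  show ?case
  proof (cases "q = Q")
    case False
    then have "Suc q * l \<le> Q * l"
      using Suc.prems by (intro mult_le_mono1) simp
    then have "q * l + n < Q * l"
      using \<open>n < l\<close> by simp
    then show ?thesis
      using Suc False by (simp add: nth_append length_concat_replicate)
  qed (simp add: nth_append length_concat_replicate assms(2))
qed simp

context jump_chain
begin

text \<open>The source \<open>v\<close> fires at some jump \<open>k + n\<close> of the stage and
  syncs \<open>w\<close>. For the remaining \<open>l - Suc n\<close> jumps all sources stay synced,
  so \<open>w\<close> does too.\<close>

lemma synced_stage: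
  assumes F: "\<And>n. n < l \<Longrightarrow> \<xi> (Suc (k + n)) = F" and l: "2 * CARD('n) \<le> l"
    and src: "\<forall>a\<in>Domain F. synced c (s k) a" and "(v, w) \<in> F"
  shows "synced c (s (k + l)) w"
proof -
  have "synced c (s k) v"
    using src \<open>(v, w) \<in> F\<close> by blast
  then obtain n where n: "n < l" "i (k + n) = v"
    using ex_fires_constant_graph[OF F l src] by blast
  have src_n: "\<forall>a\<in>Domain F. synced c (s (k + n')) a" if "n' \<le> l" for n'
    using synced_constant_graph[OF F src _ that] src by blast
  have "fires r F (s (k + n)) v (g (k + n))"
    using fire[of "k + n"] n F by simp
  then have "synced c (g (k + n)) w" "g (k + n) \<in> unit_box"
    using synced_out_neighbour[OF _ \<open>(v, w) \<in> F\<close>] fires_in_box[OF _ box] src_n[of n] n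
      \<open>(v, w) \<in> F\<close> by (blast intro: less_imp_le)+
  then have "synced c (s (Suc (k + n))) w"
    using box d flow by (rule synced_flow)
  then have w: "synced c (s (k + Suc n)) w"
    by simp
  have "\<xi> (Suc (k + Suc n + n')) = F" if "n' < l - Suc n" for n'
    using F[of "Suc n + n'"] that by (simp add: add.assoc)
  then have "synced c (s (k + Suc n + (l - Suc n))) w"
    using src_n[of "Suc n"] n w
    by (intro synced_constant_graph[of "l - Suc n" "k + Suc n" F]) auto
  then show ?thesis
    using n by simp
qed

lemma synced_after_sync_string:
  assumes root: "is_root E c"
    and block: "\<And>n. n < length (sync_string E r c) \<Longrightarrow> \<xi> (Suc (k + n)) = sync_string E r c ! n"
  shows "synced c (s (k + length (sync_string E r c))) j"
proof -
  define l where "l = ell_star r"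
  have len: "length (sync_string E r c) = qstar E c * l"
    unfolding sync_string_def l_def by (rule length_concat_replicate)
  have F: "\<xi> (Suc (k + q * l + n)) = Gq E c q" if "q < qstar E c" "n < l" for q n
  proof -
    have "Suc q * l \<le> qstar E c * l"
      using that by (intro mult_le_mono1) simp
    then have "q * l + n < length (sync_string E r c)"
      using that len by simp
    then have "\<xi> (Suc (k + (q * l + n))) = sync_string E r c ! (q * l + n)"
      by (rule block)
    then show ?thesis
      using that unfolding sync_string_def l_def by (simp add: nth_concat_replicate add.assoc)
  qed
  have synced_self: "synced c x c" for x
    by (simp add: synced_def)
  \<comment> \<open>Stated for out-neighbours of vertices nearer than \<open>q\<close>: by
    \<open>ex_predecessor\<close> this covers every vertex other than \<open>c\<close> at distance
    at most \<open>q\<close>, in particular the sources of the next stage.\<close>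
  have stage: "\<forall>v w. (v, w) \<in> E \<and> sp_dist E c v < q \<longrightarrow> synced c (s (k + q * l)) w"
    if "q \<le> qstar E c" for q
    using that
  proof (induction q)
    case (Suc q)
    have F': "\<xi> (Suc (k + q * l + n)) = Gq E c q" if "n < l" for n
      using F Suc.prems that by simp
    have src: "\<forall>a\<in>Domain (Gq E c q). synced c (s (k + q * l)) a"
    proof safe
      fix a b assume "(a, b) \<in> Gq E c q"
      then have "sp_dist E c a = q"
        by (simp add: Gq_iff Vq_def)
      then show "synced c (s (k + q * l)) a"
        using ex_predecessor[OF root, of a] Suc synced_self by (cases "a = c") auto
    qed
    have step: "k + Suc q * l = k + q * l + l"
      by simp
    show ?case
      unfolding step
    proof (intro allI impI, elim conjE)
      fix v w assume vw: "(v, w) \<in> E" "sp_dist E c v < Suc q"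
      show "synced c (s (k + q * l + l)) w"
      proof (cases "sp_dist E c v = q")
        case True
        then have "(v, w) \<in> Gq E c q"
          using vw root_in_Vq[OF root, of v] by (simp add: Gq_iff)
        then show ?thesis
          using synced_stage[OF F' _ src] two_card_le_ell_star[OF r] unfolding l_def by blast
      next
        case False
        then have "sp_dist E c v < q"
          using vw by simp
        then have "synced c (s (k + q * l)) w"
          using Suc.IH Suc.prems vw by auto
        then show ?thesis
          using synced_constant_graph[OF F' src] by blast
      qed
    qed
  qed simp
  show ?thesis
  proof (cases "j = c")
    case False
    then obtain v where "(v, j) \<in> E" "sp_dist E c v < sp_dist E c j"
      using ex_predecessor[OF root] by blast
    then show ?thesis
      using stage[of "qstar E c"] sp_dist_le_qstar[OF root, of j] unfolding len
      by (meson le_refl less_le_trans)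
  qed (simp add: synced_self)
qed

lemma synced_persists:
  assumes "\<forall>j. synced c (s k) j" "k \<le> k'"
  shows "\<forall>j. synced c (s k') j"
  using assms(2) assms(1) by (induction rule: dec_induct) (auto intro: synced_step)

end

subsection \<open>Flows and jumps of solutions\<close>

lemma closed_unit_box: "closed (unit_box :: (real^'n) set)"
  unfolding unit_box_def by (intro closed_Collect_all closed_Collect_conj closed_Collect_le continuous_intros)

lemma D_tau_iff: "x \<in> D_tau \<longleftrightarrow> x \<in> unit_box \<and> (\<exists>i. x $ i = 1)"
proof -
  have "Max (range (($) x)) = 1 \<longleftrightarrow> (\<exists>i. x $ i = 1)" if "x \<in> unit_box"
  proof -
    have "\<forall>i. x $ i \<le> 1"
      using that by (simp add: unit_box_def)
    moreover have "1 \<in> range (($) x) \<longleftrightarrow> (\<exists>i. x $ i = 1)"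
      by (metis rangeE rangeI)
    ultimately show ?thesis
      by (simp add: Max_eq_iff)
  qed
  then show ?thesis
    by (auto simp: D_tau_def)
qed

text \<open>\<open>R_set\<close> takes both values at the threshold, so \<open>B\<close> can express
  it by non-strict inequalities. The graph is thus a finite union of closed sets, and
  \<open>Gmap\<close> coincides with \<open>G0\<close> on \<open>D_tau\<close>.\<close>

lemma closed_graph_G0:
  fixes r :: "real^'n"
  shows "closed {(x, g). x \<in> D_tau \<and> g \<in> G0 r El x}" (is "closed ?G")
proof -
  define B where "B i j = {p :: (real^'n) \<times> (real^'n).
    if (i, j) \<in> El then (snd p $ j = 0 \<and> fst p $ j \<le> r $ j) \<or> (snd p $ j = 1 \<and> r $ j \<le> fst p $ j)
    else snd p $ j = fst p $ j}" for i j
  have "closed (B i j)" for i j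
    unfolding B_def
    by (cases "(i, j) \<in> El") (auto intro!: closed_Collect_disj closed_Collect_conj
        closed_Collect_le closed_Collect_eq continuous_intros)
  then have "closed (\<Union>i. {p. fst p \<in> unit_box} \<inter> {p. fst p $ i = 1} \<inter> {p. snd p $ i = 0} \<inter> (\<Inter>j\<in>-{i}. B i j))"
    by (intro closed_UN closed_Int closed_INT ballI closed_Collect_eq continuous_intros
        closed_vimage[OF closed_unit_box, unfolded vimage_def]) auto
  moreover have "?G = (\<Union>i. {p. fst p \<in> unit_box} \<inter> {p. fst p $ i = 1} \<inter> {p. snd p $ i = 0} \<inter> (\<Inter>j\<in>-{i}. B i j))"
  proof -
    have "g $ j \<in> R_set r El x i j \<longleftrightarrow> (x, g) \<in> B i j" for x g :: "real^'n" and i j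
      by (auto simp: R_set_def B_def)
    then show ?thesis
      by (auto simp: G0_def D_tau_iff)
  qed
  ultimately show ?thesis
    by simp
qed

lemma Gmap_iff: "g \<in> Gmap r El x \<longleftrightarrow> x \<in> D_tau \<and> (\<exists>i. fires r El x i g)"
  unfolding Gmap_def using closed_graph_G0[of r El] by (simp add: G0_iff_fires)

lemma Gmap_nonempty:
  assumes "x \<in> D_tau"
  shows "\<exists>g. g \<in> Gmap r El x"
proof -
  obtain i where "x $ i = 1"
    using assms by (auto simp: D_tau_iff)
  have "R_set r El x i j \<noteq> {}" for j
    by (simp add: R_set_def)
  then have "fires r El x i (\<chi> j. if j = i then 0 else SOME y. y \<in> R_set r El x i j)"
    using \<open>x $ i = 1\<close> by (simp add: fires_def some_in_eq)
  then show ?thesis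
    using assms Gmap_iff by blast
qed

lemma abs_cont_on_affine:
  fixes f :: "real \<Rightarrow> 'a::real_normed_vector"
  assumes "\<And>t. t \<in> I \<Longrightarrow> f t = x + (t - a) *\<^sub>R c"
  shows "abs_cont_on I f"
  unfolding abs_cont_on_def
proof (intro allI impI)
  fix e :: real assume "e > 0"
  \<comment> \<open>The summand 1 keeps the denominator positive when \<open>c = 0\<close>.\<close>
  define \<delta> where "\<delta> = e / (norm c + 1)"
  have pos: "0 < norm c + 1"
    using norm_ge_zero[of c] by linarith
  have "(\<Sum>k<n. norm (f (q k) - f (p k))) < e"
    if pq: "\<forall>k<n. p k \<in> I \<and> q k \<in> I \<and> p k \<le> q k" and len: "(\<Sum>k<n. q k - p k) < \<delta>"
    for n :: nat and p q :: "nat \<Rightarrow> real"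
  proof -
    have "norm (f (q k) - f (p k)) = (q k - p k) * norm c" if "k < n" for k
    proof -
      have "f (q k) - f (p k) = (q k - p k) *\<^sub>R c"
        using pq that by (simp add: assms algebra_simps)
      then show ?thesis
        using pq that by simp
    qed
    then have "(\<Sum>k<n. norm (f (q k) - f (p k))) = (\<Sum>k<n. q k - p k) * norm c"
      by (simp add: sum_distrib_right)
    also have "\<dots> \<le> (\<Sum>k<n. q k - p k) * (norm c + 1)"
      using pq by (intro mult_left_mono sum_nonneg) auto
    also have "\<dots> < e"
      using len pos by (simp add: \<delta>_def pos_less_divide_eq)
    finally show ?thesis .
  qed
  moreover have "0 < \<delta>"
    using \<open>e > 0\<close> pos by (simp add: \<delta>_def)
  ultimately show "\<exists>\<delta>>0. \<forall>n p q. (\<forall>k<n. p k \<in> I \<and> q k \<in> I \<and> p k \<le> q k) \<and>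
      (\<forall>k. Suc k < n \<longrightarrow> q k \<le> p (Suc k)) \<and> (\<Sum>k<n. q k - p k) < \<delta> \<longrightarrow>
      (\<Sum>k<n. norm (f (q k) - f (p k))) < e"
    by blast
qed

section \<open>Hybrid time domains\<close>

text \<open>Since the corner \<open>(t, k)\<close> itself belongs to \<open>dm\<close>, the
  truncation has exactly the levels up to \<open>k\<close>, and its last interval ends at
  \<open>t\<close>.\<close>

lemma htd_truncation:
  assumes "hybrid_time_domain dm" "(t, k) \<in> dm"
  obtains \<theta> :: "nat \<Rightarrow> real" where "\<theta> 0 = 0" "\<forall>j\<le>k. \<theta> j \<le> \<theta> (Suc j)" "\<theta> (Suc k) = t"
    "dm \<inter> ({0..t} \<times> {0..k}) = (\<Union>j\<le>k. {\<theta> j..\<theta> (Suc j)} \<times> {j})"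
proof -
  have "compact_htd (dm \<inter> ({0..t} \<times> {0..k}))" "0 \<le> t"
    using assms unfolding hybrid_time_domain_def by auto
  then obtain J \<theta> where \<theta>: "\<theta> 0 = (0 :: real)" "\<And>j. j < J \<Longrightarrow> \<theta> j \<le> \<theta> (Suc j)"
    and eq: "dm \<inter> ({0..t} \<times> {0..k}) = (\<Union>j<J. {\<theta> j..\<theta> (Suc j)} \<times> {j})"
    unfolding compact_htd_def by blast
  have "(t, k) \<in> (\<Union>j<J. {\<theta> j..\<theta> (Suc j)} \<times> {j})"
    unfolding eq[symmetric] using assms(2) \<open>0 \<le> t\<close> by simp
  then have kJ: "k < J" "t \<le> \<theta> (Suc k)"
    by auto
  have sub: "(\<theta> (Suc j), j) \<in> dm \<inter> ({0..t} \<times> {0..k})" if "j < J" for j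
    unfolding eq using that \<theta>(2) by auto
  have "J = Suc k"
    using sub[of "J - 1"] kJ by auto
  moreover have "\<theta> (Suc k) = t"
    using sub[of k] kJ by auto
  ultimately show ?thesis
    using that[of \<theta>] \<theta> eq by (simp add: lessThan_Suc_atMost less_Suc_eq_le)
qed

lemma htd_ge_0: "hybrid_time_domain dm \<Longrightarrow> (t, k) \<in> dm \<Longrightarrow> 0 \<le> t"
  unfolding hybrid_time_domain_def by auto

lemma htd_convex:
  assumes "hybrid_time_domain dm" "(a, k) \<in> dm" "(b, k) \<in> dm" "a \<le> t" "t \<le> b"
  shows "(t, k) \<in> dm"
proof -
  obtain \<theta> :: "nat \<Rightarrow> real" where "\<theta> 0 = 0" "\<forall>j\<le>k. \<theta> j \<le> \<theta> (Suc j)"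
    and \<theta>: "\<theta> (Suc k) = b"
      "dm \<inter> ({0..b} \<times> {0..k}) = (\<Union>j\<le>k. {\<theta> j..\<theta> (Suc j)} \<times> {j})"
    by (rule htd_truncation[OF assms(1,3)])
  have "(a, k) \<in> dm \<inter> ({0..b} \<times> {0..k})"
    using assms htd_ge_0 by auto
  then have "(t, k) \<in> dm \<inter> ({0..b} \<times> {0..k})"
    unfolding \<theta>(2) using \<theta>(1) assms(4,5) by auto
  then show ?thesis by simp
qed

text \<open>Consecutive intervals of a truncation share the endpoint
  \<open>\<theta> (Suc j)\<close>.\<close>

lemma htd_earlier_jump:
  assumes "hybrid_time_domain dm" "(t, k) \<in> dm" "j < k"
  shows "\<exists>u\<le>t. (u, j) \<in> dm \<and> (u, Suc j) \<in> dm"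
proof -
  obtain \<theta> :: "nat \<Rightarrow> real" where "\<theta> 0 = 0"
    and \<theta>: "\<forall>j\<le>k. \<theta> j \<le> \<theta> (Suc j)" and "\<theta> (Suc k) = t"
    and trunc: "dm \<inter> ({0..t} \<times> {0..k}) = (\<Union>j\<le>k. {\<theta> j..\<theta> (Suc j)} \<times> {j})"
    by (rule htd_truncation[OF assms(1,2)])
  have "(\<theta> (Suc j), j) \<in> dm \<inter> ({0..t} \<times> {0..k})"
    unfolding trunc using \<theta>[rule_format, of j] assms(3) by auto
  moreover have "(\<theta> (Suc j), Suc j) \<in> dm \<inter> ({0..t} \<times> {0..k})"
    unfolding trunc using \<theta>[rule_format, of "Suc j"] assms(3) by auto
  ultimately show ?thesis
    by auto
qed

section \<open>Properties of a single solution\<close>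

locale hybrid_solution =
  fixes T :: real and r :: "real^'n::finite" and \<xi> dm \<tau> lam
  assumes sol: "is_solution T r \<xi> dm \<tau> lam" and T: "T > 0"
begin

lemma htd: "hybrid_time_domain dm" and start: "(0, 0) \<in> dm" "\<tau> 0 0 \<in> unit_box"
  using sol unfolding is_solution_def by auto

lemma jump:
  assumes "(t, k) \<in> dm" "(t, Suc k) \<in> dm"
  shows "\<tau> t k \<in> D_tau" "\<tau> t (Suc k) \<in> Gmap r (\<xi> (lam t k + 1)) (\<tau> t k)"
    "lam t (Suc k) = lam t k + 1"
  using sol assms unfolding is_solution_def by blast+

lemma flow_segment:
  assumes "(a, k) \<in> dm" "(b, k) \<in> dm" "a \<le> b"
  shows "\<exists>Z. negligible Z \<and> (\<forall>t\<in>{a..b} - Z. \<tau> t k \<in> unit_box)"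
    and "\<tau> b k = \<tau> a k + ((b - a) / T) *\<^sub>R (\<chi> i. 1)" and "lam b k = lam a k"
proof -
  define I where "I = {t. (t, k) \<in> dm}"
  have sub: "{a..b} \<subseteq> I"
    using htd_convex[OF htd assms(1,2)] unfolding I_def by auto
  have ac: "abs_cont_on {a..b} (\<lambda>t. \<tau> t k)" "abs_cont_on {a..b} (\<lambda>t. real (lam t k))"
    using sol sub unfolding is_solution_def loc_abs_cont_on_def Let_def I_def by blast+
  obtain Z where Z: "negligible Z" "\<And>t. t \<in> I - Z \<Longrightarrow> \<tau> t k \<in> unit_box"
    and der: "\<And>t. t \<in> I - Z \<Longrightarrow> ((\<lambda>s. \<tau> s k) has_vector_derivative ((1 / T) *\<^sub>R (\<chi> i. 1))) (at t within I)"
    "\<And>t. t \<in> I - Z \<Longrightarrow> ((\<lambda>s. real (lam s k)) has_vector_derivative 0) (at t within I)"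
    using sol unfolding is_solution_def Let_def I_def by blast
  show "\<exists>Z. negligible Z \<and> (\<forall>t\<in>{a..b} - Z. \<tau> t k \<in> unit_box)"
    using Z sub by blast
  have "\<tau> b k - \<tau> a k = (b - a) *\<^sub>R (1 / T) *\<^sub>R (\<chi> i. 1)"
    by (rule abs_cont_linear[OF assms(3) ac(1) Z(1)])
      (use sub der(1) in \<open>blast intro: has_vector_derivative_within_subset\<close>)
  then show "\<tau> b k = \<tau> a k + ((b - a) / T) *\<^sub>R (\<chi> i. 1)"
    by (simp add: algebra_simps)
  have "real (lam b k) - real (lam a k) = (b - a) *\<^sub>R 0"
    by (rule abs_cont_linear[OF assms(3) ac(2) Z(1)])
      (use sub der(2) in \<open>blast intro: has_vector_derivative_within_subset\<close>)
  then show "lam b k = lam a k"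
    by simp
qed

lemmas flow_tau = flow_segment(2) and flow_lam = flow_segment(3)

text \<open>The flow condition gives the box only almost everywhere. A negligible set contains no
  interval, so there are good times arbitrarily close to \<open>a\<close> and \<open>b\<close>;
  affine motion carries the lower bound to \<open>a\<close> and the upper bound to \<open>b\<close>,
  and monotonicity supplies the rest.\<close>

lemma flow_in_box:
  assumes "(a, k) \<in> dm" "(b, k) \<in> dm" "a < b"
  shows "\<tau> a k \<in> unit_box" "\<tau> b k \<in> unit_box"
proof -
  obtain Z where Z: "negligible Z" "\<And>t. t \<in> {a..b} - Z \<Longrightarrow> \<tau> t k \<in> unit_box"
    using flow_segment(1)[OF assms(1,2) less_imp_le[OF assms(3)]] by blast
  have dense: "\<exists>t\<in>{u<..<v}. \<tau> t k \<in> unit_box" if "a \<le> u" "u < v" "v \<le> b" for u v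
  proof (rule ccontr)
    assume no: "\<not> ?thesis"
    have "{u<..<v} \<subseteq> Z"
    proof
      fix t assume "t \<in> {u<..<v}"
      then show "t \<in> Z"
        using no Z(2)[of t] that by fastforce
    qed
    then have "negligible {u<..<v}"
      using Z(1) negligible_subset by blast
    then show False
      using that open_not_negligible[of "{u<..<v}"] by simp
  qed
  have lin: "\<tau> t k $ i = \<tau> a k $ i + (t - a) / T" if "a \<le> t" "t \<le> b" for t i
    using flow_tau[OF assms(1) htd_convex[OF htd assms(1,2) that] that(1)] by simp
  have lo: "0 \<le> \<tau> a k $ i" for i
  proof (rule field_le_epsilon)
    fix e :: real assume "e > 0"
    then obtain t where t: "a < t" "t < min b (a + e * T)" "\<tau> t k \<in> unit_box"
      using dense[of a "min b (a + e * T)"] assms(3) T by auto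
    then have "(t - a) / T < e"
      using T by (simp add: pos_divide_less_eq)
    moreover have "0 \<le> \<tau> t k $ i"
      using t by (simp add: unit_box_def)
    ultimately show "0 \<le> \<tau> a k $ i + e"
      using lin[of t i] t by simp
  qed
  have hi: "\<tau> b k $ i \<le> 1" for i
  proof (rule field_le_epsilon)
    fix e :: real assume "e > 0"
    then obtain t where t: "max a (b - e * T) < t" "t < b" "\<tau> t k \<in> unit_box"
      using dense[of "max a (b - e * T)" b] assms(3) T by auto
    then have "(b - t) / T < e"
      using T by (simp add: pos_divide_less_eq)
    moreover have "(b - t) / T = (b - a) / T - (t - a) / T"
      by (simp add: diff_divide_distrib)
    moreover have "\<tau> t k $ i \<le> 1"
      using t by (simp add: unit_box_def)
    ultimately show "\<tau> b k $ i \<le> 1 + e"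
      using lin[of t i] lin[of b i] t assms(3) by simp
  qed
  have "0 \<le> (b - a) / T"
    using assms(3) T by simp
  then have "\<tau> a k $ i \<le> \<tau> b k $ i" for i
    using lin[of b i] assms(3) by simp
  then show "\<tau> a k \<in> unit_box" "\<tau> b k \<in> unit_box"
    unfolding unit_box_def using lo hi by (auto intro: order_trans)
qed

text \<open>The definition of hybrid time domains admits branching, i.e. flowing on past a jump time.
  Here this is impossible because some component is \<open>1\<close> at jump times.\<close>

lemma le_jump_time:
  assumes "(u, k) \<in> dm" "(u, Suc k) \<in> dm" "(t, k) \<in> dm"
  shows "t \<le> u"
proof (rule ccontr)
  assume "\<not> t \<le> u"
  then have "u < t" by simp
  obtain i where "\<tau> u k $ i = 1"
    using jump(1)[OF assms(1,2)] by (auto simp: D_tau_iff)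
  then have "\<tau> t k $ i = 1 + (t - u) / T"
    using flow_tau[OF assms(1,3)] \<open>u < t\<close> by simp
  moreover have "\<tau> t k $ i \<le> 1"
    using flow_in_box(2)[OF assms(1,3) \<open>u < t\<close>] by (simp add: unit_box_def)
  moreover have "0 < (t - u) / T"
    using \<open>u < t\<close> T by simp
  ultimately show False by linarith
qed

text \<open>Any other jump time \<open>u'\<close> of level \<open>k\<close> bounds that level too,
  so \<open>u \<le> u'\<close>.\<close>

lemma jump_time_le:
  assumes "(u, k) \<in> dm" "(u, Suc k) \<in> dm" "(t, Suc k) \<in> dm"
  shows "u \<le> t"
proof -
  obtain u' where "u' \<le> t" "(u', k) \<in> dm" "(u', Suc k) \<in> dm"
    using htd_earlier_jump[OF htd assms(3) lessI] by blast
  then show ?thesis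
    using le_jump_time[of u' k u] assms(1) by linarith
qed

lemma dm_mono:
  assumes "(t, j) \<in> dm" "(t', k) \<in> dm" "j < k"
  shows "t \<le> t'"
proof -
  obtain u where u: "u \<le> t'" "(u, j) \<in> dm" "(u, Suc j) \<in> dm"
    using htd_earlier_jump[OF htd assms(2,3)] by blast
  show ?thesis
    using le_jump_time[OF u(2,3) assms(1)] u(1) by linarith
qed

text \<open>On a level that is a single point the flow condition is void; there the box comes from
  the initial state or from the jump map.\<close>

lemma in_box:
  assumes "(t, k) \<in> dm"
  shows "\<tau> t k \<in> unit_box"
proof (cases k)
  case 0
  then show ?thesis
    using flow_in_box(2)[of 0 0 t] start assms htd_ge_0[OF htd assms]
    by (cases "t = 0") auto
next
  case (Suc j)
  obtain u where u: "u \<le> t" "(u, j) \<in> dm" "(u, Suc j) \<in> dm"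
    using htd_earlier_jump[OF htd assms, of j] Suc by auto
  have "\<tau> u (Suc j) \<in> unit_box"
    using jump(1,2)[OF u(2,3)] fires_in_box by (auto simp: Gmap_iff D_tau_iff)
  then show ?thesis
    using flow_in_box(2)[OF u(3), of t] u assms Suc by (cases "u = t") auto
qed

lemma duration_le:
  assumes "(a, k) \<in> dm" "(t, k) \<in> dm"
  shows "t \<le> a + T * (1 - \<tau> a k $ i)"
proof (cases "a \<le> t")
  case True
  have "\<tau> a k $ i + (t - a) / T \<le> 1"
    using flow_tau[OF assms True] in_box[OF assms(2)] by (simp add: unit_box_def)
  then have "(t - a) / T \<le> 1 - \<tau> a k $ i"
    by simp
  then show ?thesis
    using T by (simp add: pos_divide_le_eq mult.commute)
next
  case False
  have "0 \<le> T * (1 - \<tau> a k $ i)"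
    using T in_box[OF assms(1)] by (simp add: unit_box_def)
  then show ?thesis
    using False by simp
qed

end

subsection \<open>Extension of solutions\<close>

text \<open>The flow condition on one level, isolated so that the levels of an extended solution can
  be checked separately.\<close>

definition flows :: "real \<Rightarrow> real set \<Rightarrow> (real \<Rightarrow> real^'n) \<Rightarrow> (real \<Rightarrow> nat) \<Rightarrow> bool" where
  "flows T I f l \<longleftrightarrow> loc_abs_cont_on I f \<and> loc_abs_cont_on I (\<lambda>t. real (l t)) \<and>
     (\<exists>Z. negligible Z \<and> (\<forall>t \<in> I - Z. f t \<in> unit_box \<and>
        (f has_vector_derivative ((1 / T) *\<^sub>R (\<chi> i. 1))) (at t within I) \<and>
        ((\<lambda>s. real (l s)) has_vector_derivative 0) (at t within I)))"

lemma is_solution_iff: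
  "is_solution T r \<xi> dm \<tau> lam \<longleftrightarrow>
     hybrid_time_domain dm \<and> (0, 0) \<in> dm \<and> \<tau> 0 0 \<in> unit_box \<and>
     (\<forall>k. flows T {t. (t, k) \<in> dm} (\<lambda>t. \<tau> t k) (\<lambda>t. lam t k)) \<and>
     (\<forall>t k. (t, k) \<in> dm \<and> (t, Suc k) \<in> dm \<longrightarrow> \<tau> t k \<in> D_tau \<and>
        \<tau> t (Suc k) \<in> Gmap r (\<xi> (lam t k + 1)) (\<tau> t k) \<and> lam t (Suc k) = lam t k + 1)"
  by (simp add: is_solution_def flows_def Let_def)

lemma flows_affine:
  fixes x :: "real^'n"
  assumes f: "\<And>t. t \<in> I \<Longrightarrow> f t = x + ((t - a) / T) *\<^sub>R (\<chi> i. 1)"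
    and box: "\<And>t. t \<in> I \<Longrightarrow> f t \<in> unit_box" and l: "\<And>t. t \<in> I \<Longrightarrow> l t = n"
  shows "flows T I f l"
proof -
  define c :: "real^'n" where "c = (1 / T) *\<^sub>R (\<chi> i. 1)"
  have f': "f t = x + (t - a) *\<^sub>R c" if "t \<in> I" for t
    using f[OF that] by (simp add: c_def)
  have "loc_abs_cont_on I f"
    unfolding loc_abs_cont_on_def using f' by (blast intro: abs_cont_on_affine)
  moreover have "loc_abs_cont_on I (\<lambda>t. real (l t))"
    unfolding loc_abs_cont_on_def
    using l by (intro allI impI abs_cont_on_affine[where x="real n" and a=0 and c=0]) auto
  moreover have "(f has_vector_derivative c) (at t within I)" if "t \<in> I" for t
  proof (rule has_vector_derivative_transform[OF that f'])
    show "((\<lambda>t. x + (t - a) *\<^sub>R c) has_vector_derivative c) (at t within I)"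
      by (auto intro!: derivative_eq_intros)
  qed
  moreover have "((\<lambda>s. real (l s)) has_vector_derivative 0) (at t within I)" if "t \<in> I" for t
    by (rule has_vector_derivative_transform[OF that]) (auto simp: l)
  ultimately show ?thesis
    unfolding flows_def using box by (intro conjI exI[of _ "{}"]) (auto simp: c_def)
qed

lemma loc_abs_cont_on_singleton: "loc_abs_cont_on {b} g"
  unfolding loc_abs_cont_on_def
  by (intro allI impI abs_cont_on_affine[where x="g b" and a=0 and c=0]) auto

text \<open>The point itself is taken as the exceptional negligible set.\<close>

lemma flows_singleton: "flows T {b} f l"
  unfolding flows_def
  by (intro conjI loc_abs_cont_on_singleton exI[of _ "{b}"]) auto

context hybrid_solution
begin

text \<open>Level \<open>K\<close> is prolonged to the time \<open>b\<close> at which its largest component reaches \<open>1\<close>; the new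
  point \<open>(b, Suc K)\<close> makes the extension proper even if level \<open>K\<close> was already complete.\<close>

lemma extension:
  assumes a: "(a, K) \<in> dm" and first: "\<And>t. (t, K) \<in> dm \<Longrightarrow> a \<le> t"
    and last: "\<And>t. (t, Suc K) \<notin> dm"
  shows "\<exists>dm' \<tau>' lam'. is_solution T r \<xi> dm' \<tau>' lam' \<and> dm \<subset> dm' \<and>
    (\<forall>(t, k)\<in>dm. \<tau>' t k = \<tau> t k \<and> lam' t k = lam t k)"
proof -
  define x where "x = \<tau> a K"
  have x_box: "x \<in> unit_box"
    using in_box[OF a] by (simp add: x_def)
  have "Max (range (($) x)) \<in> range (($) x)"
    by (rule Max_in) auto
  then obtain m where m: "Max (range (($) x)) = x $ m"
    by blast
  have m_max: "x $ i \<le> x $ m" for i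
    unfolding m[symmetric] by (rule Max_ge) auto
  define b where "b = a + T * (1 - x $ m)"
  have "x $ m \<le> 1"
    using x_box by (simp add: unit_box_def)
  then have "a \<le> b"
    using T by (simp add: b_def)
  define y where "y t = x + ((t - a) / T) *\<^sub>R (\<chi> i. 1)" for t
  have y_box: "y t \<in> unit_box" if "a \<le> t" "t \<le> b" for t
    unfolding unit_box_def
  proof safe
    fix i
    have "(t - a) / T \<le> 1 - x $ m"
      using that T by (simp add: b_def pos_divide_le_eq mult.commute)
    then show "y t $ i \<le> 1"
      using m_max[of i] by (simp add: y_def)
    have "0 \<le> x $ i"
      using x_box by (simp add: unit_box_def)
    then show "0 \<le> y t $ i"
      using that T by (simp add: y_def)
  qed
  have "y b $ m = 1"
    using T by (simp add: y_def b_def)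
  then have yb: "y b \<in> D_tau"
    using y_box[of b] \<open>a \<le> b\<close> by (auto simp: D_tau_iff)
  obtain g where g: "g \<in> Gmap r (\<xi> (lam a K + 1)) (y b)"
    using Gmap_nonempty[OF yb] by blast
  define dm' where "dm' = dm \<union> {a..b} \<times> {K} \<union> {(b, Suc K)}"
  define \<tau>' where "\<tau>' t k = (if k < K then \<tau> t k else if k = K then y t else g)" for t k
  define lam' where "lam' t k = (if k < K then lam t k else if k = K then lam a K else lam a K + 1)" for t k
  have above: "k \<le> K" if "(t, k) \<in> dm" for t k
    using htd_earlier_jump[OF htd that, of K] last by (meson not_le)
  have le_b: "t \<le> b" if "(t, K) \<in> dm" for t
    unfolding b_def x_def by (rule duration_le[OF a that])
  have mem_less: "(t, k) \<in> dm' \<longleftrightarrow> (t, k) \<in> dm" if "k < K" for t k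
    using that by (auto simp: dm'_def)
  have mem_K: "(t, K) \<in> dm' \<longleftrightarrow> t \<in> {a..b}" for t
    using first le_b by (auto simp: dm'_def)
  have mem_Suc: "(t, Suc K) \<in> dm' \<longleftrightarrow> t = b" for t
    using last by (auto simp: dm'_def)
  have mem_greater: "(t, k) \<notin> dm'" if "Suc K < k" for t k
    using above that by (force simp: dm'_def)
  have before_a: "t \<le> a" if "(t, k) \<in> dm" "k < K" for t k
    using dm_mono[OF that(1) a that(2)] .
  have "0 \<le> a"
    using htd_ge_0[OF htd a] .
  have "hybrid_time_domain dm'"
    unfolding hybrid_time_domain_def
  proof (intro conjI allI impI)
    show "dm' \<subseteq> {0..} \<times> UNIV"
      using htd_ge_0[OF htd] \<open>0 \<le> a\<close> \<open>a \<le> b\<close> by (fastforce simp: dm'_def)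
    fix P J assume PJ: "(P, J) \<in> dm'"
    show "compact_htd (dm' \<inter> ({0..P} \<times> {0..J}))"
    proof (cases "J < K")
      case True
      then have "dm' \<inter> ({0..P} \<times> {0..J}) = dm \<inter> ({0..P} \<times> {0..J})"
        using mem_less by auto
      moreover have "(P, J) \<in> dm"
        using PJ mem_less[OF True] by blast
      ultimately show ?thesis
        using htd unfolding hybrid_time_domain_def by simp
    next
      case False
      then have J: "J = K \<and> a \<le> P \<and> P \<le> b \<or> J = Suc K \<and> P = b"
        using PJ mem_K[of P] mem_Suc[of P] mem_greater[of J P]
        by (metis atLeastAtMost_iff linorder_neqE_nat not_less_eq)
      obtain \<theta> :: "nat \<Rightarrow> real" where \<theta>: "\<theta> 0 = 0" "\<forall>j\<le>K. \<theta> j \<le> \<theta> (Suc j)" "\<theta> (Suc K) = a"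
        "dm \<inter> ({0..a} \<times> {0..K}) = (\<Union>j\<le>K. {\<theta> j..\<theta> (Suc j)} \<times> {j})"
        by (rule htd_truncation[OF htd a])
      \<comment> \<open>Level \<open>K\<close> starts at \<open>a\<close>, so truncating at
        \<open>(a, K)\<close> reduces it to the single time \<open>a\<close>.\<close>
      have "(\<theta> K, K) \<in> dm \<inter> ({0..a} \<times> {0..K})"
        unfolding \<theta>(4) using \<theta>(2) by auto
      then have "\<theta> K = a"
        using first by force
      \<comment> \<open>Old breakpoints up to \<open>K\<close>, then \<open>P\<close> forever: level
        \<open>K\<close> becomes \<open>{a..P}\<close>, and level \<open>Suc K\<close>, if present,
        the single time \<open>P = b\<close>.\<close>
      define \<theta>' where "\<theta>' j = (if j \<le> K then \<theta> j else P)" for j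
      have "(t, k) \<in> dm' \<inter> ({0..P} \<times> {0..J}) \<longleftrightarrow> (t, k) \<in> (\<Union>j<Suc J. {\<theta>' j..\<theta>' (Suc j)} \<times> {j})" for t k
      proof -
        consider "k < K" | "k = K" | "k = Suc K" | "Suc K < k"
          by linarith
        then show ?thesis
        proof cases
          case 1
          have "(t, k) \<in> dm' \<inter> ({0..P} \<times> {0..J}) \<longleftrightarrow> (t, k) \<in> dm \<inter> ({0..a} \<times> {0..K})"
          proof (cases "(t, k) \<in> dm")
            case True
            then have "t \<le> a" "t \<le> P"
              using before_a[OF True 1] J \<open>a \<le> b\<close> by auto
            then show ?thesis
              using 1 True mem_less[OF 1] J by auto
          qed (use mem_less[OF 1] in simp)
          also have "\<dots> \<longleftrightarrow> t \<in> {\<theta> k..\<theta> (Suc k)}"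
            unfolding \<theta>(4) using 1 by auto
          also have "\<dots> \<longleftrightarrow> (t, k) \<in> (\<Union>j<Suc J. {\<theta>' j..\<theta>' (Suc j)} \<times> {j})"
            using 1 J by (auto simp: \<theta>'_def)
          finally show ?thesis .
        next
          case 2
          then show ?thesis
            using mem_K[of t] J \<open>\<theta> K = a\<close> \<open>0 \<le> a\<close> by (auto simp: \<theta>'_def)
        next
          case 3
          then show ?thesis
            using mem_Suc[of t] J \<open>0 \<le> a\<close> \<open>a \<le> b\<close> by (auto simp: \<theta>'_def)
        next
          case 4
          then show ?thesis
            using mem_greater[OF 4, of t] J by auto
        qed
      qed
      then have "dm' \<inter> ({0..P} \<times> {0..J}) = (\<Union>j<Suc J. {\<theta>' j..\<theta>' (Suc j)} \<times> {j})"
        by (simp only: set_eq_iff split_paired_All) blast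
      moreover have "\<theta>' 0 = 0"
        using \<theta>(1) by (simp add: \<theta>'_def)
      moreover have "\<theta>' j \<le> \<theta>' (Suc j)" if "j < Suc J" for j
        using that \<theta>(2) \<open>\<theta> K = a\<close> J \<open>a \<le> b\<close> by (auto simp: \<theta>'_def not_less_eq_eq le_antisym)
      ultimately show ?thesis
        unfolding compact_htd_def by blast
    qed
  qed
  moreover have "(0, 0) \<in> dm'"
    using start by (simp add: dm'_def)
  moreover have agree: "\<tau>' t k = \<tau> t k \<and> lam' t k = lam t k" if "(t, k) \<in> dm" for t k
  proof (cases "k < K")
    case False
    then have "k = K"
      using above[OF that] by simp
    then show ?thesis
      using flow_tau[OF a, of t] flow_lam[OF a, of t] that first
      by (simp add: \<tau>'_def lam'_def y_def x_def)
  qed (simp add: \<tau>'_def lam'_def)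
  moreover have "\<tau>' 0 0 \<in> unit_box"
    using agree[OF start(1)] start(2) by simp
  moreover have "flows T {t. (t, k) \<in> dm'} (\<lambda>t. \<tau>' t k) (\<lambda>t. lam' t k)" for k
  proof -
    consider "k < K" | "k = K" | "k = Suc K" | "Suc K < k"
      by linarith
    then show ?thesis
    proof cases
      case 1
      have "flows T {t. (t, k) \<in> dm} (\<lambda>t. \<tau> t k) (\<lambda>t. lam t k)"
        using sol unfolding is_solution_iff by blast
      then show ?thesis
        using 1 mem_less[OF 1] by (simp add: \<tau>'_def lam'_def)
    next
      case 2
      show ?thesis
        unfolding 2 mem_K
        by (rule flows_affine[where x=x and a=a and n="lam a K"])
          (use y_box in \<open>auto simp: \<tau>'_def lam'_def y_def\<close>)
    next
      case 3
      show ?thesis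
        unfolding 3 mem_Suc using flows_singleton by simp
    next
      case 4
      then show ?thesis
        using mem_greater[OF 4] by (intro flows_affine) auto
    qed
  qed
  moreover have "\<tau>' t k \<in> D_tau \<and> \<tau>' t (Suc k) \<in> Gmap r (\<xi> (lam' t k + 1)) (\<tau>' t k) \<and>
    lam' t (Suc k) = lam' t k + 1" if tk: "(t, k) \<in> dm'" "(t, Suc k) \<in> dm'" for t k
  proof (cases "k < K")
    case True
    have "(t, k) \<in> dm"
      using tk(1) mem_less[OF True] by blast
    moreover have "(t, Suc k) \<in> dm"
    proof (cases "Suc k = K")
      case False
      then show ?thesis
        using tk(2) mem_less[of "Suc k"] True by simp
    next
      case eq: True
      \<comment> \<open>Level \<open>K\<close> of \<open>dm'\<close> begins at \<open>a\<close> and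
        earlier levels end by \<open>a\<close>, so prolonging level \<open>K\<close> creates no new
        jump into it.\<close>
      then have "t = a"
        using tk(2) mem_K[of t] before_a[OF \<open>(t, k) \<in> dm\<close> True] by auto
      then show ?thesis
        using a eq by simp
    qed
    ultimately show ?thesis
      using jump[of t k] agree[of t k] agree[of t "Suc k"] by simp
  next
    case False
    have "\<not> Suc K < Suc k"
      using tk(2) mem_greater by blast
    then have "k = K" "t = b"
      using False tk(2) mem_Suc by auto
    then show ?thesis
      using yb g by (simp add: \<tau>'_def lam'_def)
  qed
  ultimately have "is_solution T r \<xi> dm' \<tau>' lam'"
    unfolding is_solution_iff by blast
  moreover have "dm \<subset> dm'"
    using last by (auto simp: dm'_def)
  ultimately show ?thesis
    using agree by blast
qed

text \<open>By \<open>extension\<close>, a maximal solution cannot have a last level. Each level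
  begins at the preceding jump time, or at 0, and lasts at most \<open>T\<close>, which gives a
  bound independent of the solution.\<close>

lemma ex_jump_time:
  assumes maximal: "\<nexists>dm' \<tau>' lam'. is_solution T r \<xi> dm' \<tau>' lam' \<and> dm \<subset> dm' \<and>
    (\<forall>(t, k)\<in>dm. \<tau>' t k = \<tau> t k \<and> lam' t k = lam t k)"
  shows "\<exists>u. (u, k) \<in> dm \<and> (u, Suc k) \<in> dm \<and> u \<le> real (Suc k) * T"
proof -
  have step: "\<exists>u. (u, k) \<in> dm \<and> (u, Suc k) \<in> dm \<and> u \<le> a + T"
    if a: "(a, k) \<in> dm" and first: "\<And>t. (t, k) \<in> dm \<Longrightarrow> a \<le> t" for a k
  proof -
    obtain t where "(t, Suc k) \<in> dm"
      using extension[OF a first] maximal by blast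
    then obtain u where u: "(u, k) \<in> dm" "(u, Suc k) \<in> dm"
      using htd_earlier_jump[OF htd _ lessI] by blast
    fix i
    have "T * (1 - \<tau> a k $ i) \<le> T * 1"
      using in_box[OF a] T by (intro mult_left_mono) (auto simp: unit_box_def)
    then have "u \<le> a + T"
      using duration_le[OF a u(1), of i] by simp
    then show ?thesis
      using u by blast
  qed
  show ?thesis
  proof (induction k)
    case 0
    show ?case
      using step[OF start(1) htd_ge_0[OF htd]] by simp
  next
    case (Suc k)
    then obtain a where a: "(a, k) \<in> dm" "(a, Suc k) \<in> dm" "a \<le> real (Suc k) * T"
      by blast
    obtain u where "(u, Suc k) \<in> dm" "(u, Suc (Suc k)) \<in> dm" "u \<le> a + T"
      using step[OF a(2) jump_time_le[OF a(1,2)]] by blast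
    moreover have "a + T \<le> real (Suc (Suc k)) * T"
      using a(3) by (simp add: algebra_simps)
    ultimately show ?case
      by (meson order_trans)
  qed
qed

text \<open>Shows that jump \<open>k\<close> uses the graph \<open>\<xi> (Suc k)\<close> in every
  solution.\<close>

lemma lam_eq:
  assumes "lam 0 0 = 0" "(t, k) \<in> dm"
  shows "lam t k = k"
  using assms(2)
proof (induction k arbitrary: t)
  case 0
  then show ?case
    using flow_lam[OF start(1) 0 htd_ge_0[OF htd 0]] assms(1) by simp
next
  case (Suc k)
  obtain u where u: "u \<le> t" "(u, k) \<in> dm" "(u, Suc k) \<in> dm"
    using htd_earlier_jump[OF htd Suc.prems lessI] by blast
  then show ?case
    using flow_lam[OF u(3) Suc.prems u(1)] jump(3)[OF u(2,3)] Suc.IH[OF u(2)] by simp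
qed

end

subsection \<open>Finite-time synchronization\<close>

theorem theorem1:
  fixes E :: "('n::finite \<times> 'n) set"
    and T :: real
    and r :: "real^'n"
    and \<xi> :: "nat \<Rightarrow> ('n \<times> 'n) set"
  assumes "simple_digraph E"
    and "rooted E"
    and "T > 0"
    and "\<forall>i. 0 < r $ i \<and> r $ i < 1"
    and "in_Xi E \<xi>"
    and "\<exists>i\<in>roots E. contains_block \<xi> (sync_string E r i)"
  shows "\<exists>tbar kbar. tbar \<ge> 0 \<and>
    (\<forall>dm \<tau> lam. is_maximal_solution T r \<xi> dm \<tau> lam \<and> lam 0 0 = 0 \<and> \<tau> 0 0 \<in> unit_box \<longrightarrow>
       (\<exists>tst kst. (tst, kst) \<in> dm \<and> tst \<le> tbar \<and> kst \<le> kbar \<and>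
          (\<forall>t k. (t, k) \<in> dm \<and> tst \<le> t \<and> kst \<le> k \<longrightarrow> \<tau> t k \<in> A_s)))"
proof -
  obtain c m where root: "is_root E c" and "m \<ge> 1"
    and block: "\<And>n. n < length (sync_string E r c) \<Longrightarrow> \<xi> (m + n) = sync_string E r c ! n"
    using assms(6) unfolding contains_block_def roots_def by blast
  \<comment> \<open>Jump \<open>k\<close> uses \<open>\<xi> (Suc k)\<close>, so a block at index
    \<open>m\<close> starts with jump \<open>m - 1\<close>, and \<open>s K\<close> is the first
    sampled state after the whole string.\<close>
  define K where "K = m - 1 + length (sync_string E r c)"
  \<comment> \<open>Jump \<open>K\<close> happens by time \<open>real (Suc K) * T\<close>; the point
    right after it, \<open>(u K, Suc K)\<close>, serves as the witness.\<close>
  show ?thesis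
  proof (rule exI[of _ "real (Suc K) * T"], rule exI[of _ "Suc K"], intro conjI allI impI)
    show "0 \<le> real (Suc K) * T"
      using assms(3) by simp
    fix dm \<tau> lam
    assume hyp: "is_maximal_solution T r \<xi> dm \<tau> lam \<and> lam 0 0 = 0 \<and> \<tau> 0 0 \<in> unit_box"
    then have sol: "is_solution T r \<xi> dm \<tau> lam"
      and maximal: "\<nexists>dm' \<tau>' lam'. is_solution T r \<xi> dm' \<tau>' lam' \<and> dm \<subset> dm' \<and>
        (\<forall>(t, k)\<in>dm. \<tau>' t k = \<tau> t k \<and> lam' t k = lam t k)"
      unfolding is_maximal_solution_def by blast+
    interpret hybrid_solution T r \<xi> dm \<tau> lam
      using sol assms(3) by unfold_locales
    obtain u where u: "\<And>k. (u k, k) \<in> dm" "\<And>k. (u k, Suc k) \<in> dm" "\<And>k. u k \<le> real (Suc k) * T"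
      using ex_jump_time[OF maximal] by metis
    have lam: "lam (u k) k = k" for k
      using lam_eq u(1) hyp by blast
    define s where "s k = \<tau> (u k) k" for k
    define g where "g k = \<tau> (u k) (Suc k)" for k
    have "\<exists>i. fires r (\<xi> (Suc k)) (s k) i (g k)" for k
      using jump(2)[OF u(1,2), of k] unfolding lam s_def g_def Gmap_iff by simp
    then obtain i where fire: "\<And>k. fires r (\<xi> (Suc k)) (s k) (i k) (g k)"
      by metis
    have later: "u k \<le> t" if "(t, Suc k) \<in> dm" for t k
      using jump_time_le[OF u(1,2) that] .
    have flow_g: "\<tau> t (Suc k) = g k + ((t - u k) / T) *\<^sub>R (\<chi> i. 1)" if "(t, Suc k) \<in> dm" for t k
      unfolding g_def by (rule flow_tau[OF u(2) that later[OF that]])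
    interpret jump_chain r \<xi> s g i "\<lambda>k. (u (Suc k) - u k) / T"
    proof
      show "s k \<in> unit_box" for k
        unfolding s_def using in_box u(1) .
      show "s (Suc k) = g k + ((u (Suc k) - u k) / T) *\<^sub>R (\<chi> i. 1)" for k
        unfolding s_def by (rule flow_g[OF u(1)])
      show "0 \<le> (u (Suc k) - u k) / T" for k
        using later[OF u(1)] assms(3) by simp
    qed (use assms(4) fire in auto)
    have "\<xi> (Suc (m - 1 + n)) = sync_string E r c ! n" if "n < length (sync_string E r c)" for n
      using block[OF that] \<open>m \<ge> 1\<close> by simp
    then have "\<forall>j. synced c (s K) j"
      unfolding K_def using synced_after_sync_string[OF root] by blast
    then have synced: "synced c (s k) j" if "K \<le> k" for k j
      using synced_persists that by blast
    \<comment> \<open>Points between jumps: level \<open>Suc k'\<close> is reached by flowing from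
      \<open>g k'\<close>, so one jump from \<open>s k'\<close> and one flow step are
      enough.\<close>
    have "\<tau> t k \<in> A_s" if "(t, k) \<in> dm" "Suc K \<le> k" for t k
    proof -
      obtain k' where k: "k = Suc k'" "K \<le> k'"
        using \<open>Suc K \<le> k\<close> Suc_le_D by blast
      have "synced c (\<tau> t k) j" for j
      proof (rule synced_flow)
        show "synced c (g k') j"
          using synced_fires[OF fire] synced[OF k(2)] by blast
        show "g k' \<in> unit_box"
          using fires_in_box[OF fire box] .
        show "\<tau> t k \<in> unit_box"
          using in_box that(1) .
        show "0 \<le> (t - u k') / T"
          using later that(1) k(1) assms(3) by simp
        show "\<tau> t k = g k' + ((t - u k') / T) *\<^sub>R (\<chi> i. 1)"
          using flow_g that(1) k(1) by simp
      qed
      then show ?thesis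
        using A_s_iff_synced[OF in_box[OF that(1)]] by blast
    qed
    then show "\<exists>tst kst. (tst, kst) \<in> dm \<and> tst \<le> real (Suc K) * T \<and> kst \<le> Suc K \<and>
      (\<forall>t k. (t, k) \<in> dm \<and> tst \<le> t \<and> kst \<le> k \<longrightarrow> \<tau> t k \<in> A_s)"
      using u(2,3)[of K] by blast
  qed
qed

end
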